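(* Let $M,N$ be positive integers, $\{x\}=\{x_1,\dots,x_N\}$, $\{y\}=\{y_1,\dots,y_N\}$. Then, as formal power series, $$\langle 0|\mathbf{C}^{*}(x_N)\cdots\mathbf{C}^{*}(x_1)\mathbf{B}^{*}(y_1)\cdots \mathbf{B}^{*}(y_N)|0\rangle=\frac{1}{\sum_{\mu\subseteq[N,M]}s_\mu\{x\}s_\mu\{y\}},$$ where $\mu$ runs over partitions with at most $N$ parts and largest part at most $M$. In particular, when $M\to\infty$, $$\lim_{M\to\infty}\langle 0|\mathbf{C}^{*}(x_N)\cdots\mathbf{C}^{*}(x_1)\mathbf{B}^{*}(y_1)\cdots \mathbf{B}^{*}(y_N)|0\rangle=\prod_{i,j=1}^N(1-x_iy_j)=\frac{1}{\sum_{l(\mu)\leq N}s_\mu\{x\}s_\mu\{y\}}.$$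
   Context: The charged free bosons $\varphi_i,\varphi^*_i$ ($i\in\mathbb Z$) satisfy $[\varphi_i,\varphi^*_j]=\delta_{i,-j}$, $[\varphi_i,\varphi_j]=[\varphi^*_i,\varphi^*_j]=0$. The vacuum satisfies $\varphi_i|0\rangle=\varphi^*_{i+1}|0\rangle=0$ for $i\ge0$, and the dual vacuum satisfies $\langle 0|\varphi_i=\langle0|\varphi^*_{i+1}=0$ for $i<0$. $\langle 0|a|0\rangle$ is the vacuum expectation value determined by these relations and $\langle 0|1|0\rangle=1$. For a fixed positive integer $M$, $$\mathbf B^*(x)=\exp(x\varphi_{-M}\varphi^*_{M-1})\exp(x\varphi_{-M+1}\varphi^*_{M-2})\cdots,\qquad \mathbf C^*(x)=\cdots\exp(x\varphi_{-M+2}\varphi^*_{M-1})\exp(x\varphi_{-M+1}\varphi^*_{M}),$$ i.e. the ordered products of $\exp(x\varphi_{-i}\varphi^*_{i-1})$ ($i\le M$, $i$ decreasing from left to right) and of $\exp(x\varphi_{-i+1}\varphi^*_{i})$ ($i\le M$, $i$ decreasing from right to left); for each fixed vector and each power of $x$ only finitely many terms contribute. $s_\mu\{x\}$ is the Schur polynomial $\det(h_{\mu_i-i+j}(x_1,\dots,x_N))$, with $h_k$ the complete symmetric polynomials; $l(\mu)$ is the length of $\mu$. Limits in $M$ are taken coefficientwise. *)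

theory Defs
  imports
    "HOL-Library.Poly_Mapping"
    "HOL-Library.Multiset"
    "HOL-Analysis.Infinite_Sum"
    "Jordan_Normal_Form.Determinant"
begin

section \<open>Formal power series in several commuting variables\<close>

text \<open>Variables are indexed by an arbitrary type; a monomial is a finitely supported exponent
  vector, and a series is an arbitrary family of coefficients indexed by the monomials.\<close>

typedef ('i, 'a) mps = "UNIV :: (('i \<Rightarrow>\<^sub>0 nat) \<Rightarrow> 'a) set"
  morphisms mps_coeff Abs_mps ..

lemma mps_coeff_Abs [simp]: "mps_coeff (Abs_mps f) = f"
  by (simp add: Abs_mps_inverse)

lemma mps_eqI: "(\<And>m. mps_coeff f m = mps_coeff g m) \<Longrightarrow> f = g"
  by (metis ext mps_coeff_inject)

definition splits :: "('i \<Rightarrow>\<^sub>0 nat) \<Rightarrow> (('i \<Rightarrow>\<^sub>0 nat) \<times> ('i \<Rightarrow>\<^sub>0 nat)) set" where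
  "splits m = {(p, q). p + q = m}"

lemma finite_splits [simp, intro]: "finite (splits m)"
proof -
  let ?D = "{p :: 'a \<Rightarrow>\<^sub>0 nat. \<forall>i. Poly_Mapping.lookup p i \<le> Poly_Mapping.lookup m i}"
  have "inj_on (\<lambda>p. restrict (Poly_Mapping.lookup p) (Poly_Mapping.keys m)) ?D"
  proof (rule inj_onI)
    fix p q assume p: "p \<in> ?D" and q: "q \<in> ?D"
      and eq: "restrict (Poly_Mapping.lookup p) (Poly_Mapping.keys m) = restrict (Poly_Mapping.lookup q) (Poly_Mapping.keys m)"
    show "p = q"
    proof (rule poly_mapping_eqI)
      fix i
      show "Poly_Mapping.lookup p i = Poly_Mapping.lookup q i"
      proof (cases "i \<in> Poly_Mapping.keys m")
        case True
        then show ?thesis using fun_cong[OF eq, of i] by simp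
      next
        case False
        then have "Poly_Mapping.lookup m i = 0" by (simp add: in_keys_iff)
        then show ?thesis using p q by (metis (mono_tags) le_zero_eq mem_Collect_eq)
      qed
    qed
  qed
  moreover have "(\<lambda>p. restrict (Poly_Mapping.lookup p) (Poly_Mapping.keys m)) ` ?D \<subseteq> PiE (Poly_Mapping.keys m) (\<lambda>i. {..Poly_Mapping.lookup m i})"
    by auto
  moreover have "finite (PiE (Poly_Mapping.keys m) (\<lambda>i. {..Poly_Mapping.lookup m i}))"
    by (simp add: finite_PiE)
  ultimately have fin: "finite ?D"
    by (meson finite_imageD finite_subset)
  have "splits m \<subseteq> ?D \<times> ?D"
    by (auto simp: splits_def lookup_add)
  then show ?thesis
    by (rule finite_subset) (use fin in simp)
qed

instantiation mps :: (type, comm_ring_1) comm_ring_1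
begin

definition "0 = Abs_mps (\<lambda>_. 0)"
definition "1 = Abs_mps (\<lambda>m. if m = 0 then 1 else 0)"
definition "f + g = Abs_mps (\<lambda>m. mps_coeff f m + mps_coeff g m)"
definition "f - g = Abs_mps (\<lambda>m. mps_coeff f m - mps_coeff g m)"
definition "- f = Abs_mps (\<lambda>m. - mps_coeff f m)"
definition "f * g = Abs_mps (\<lambda>m. \<Sum>(p, q)\<in>splits m. mps_coeff f p * mps_coeff g q)"

instance
proof
  fix a b c :: "('a, 'b) mps"
  show "a * b * c = a * (b * c)"
  proof (rule mps_eqI)
    fix m
    let ?f = "\<lambda>p q r. mps_coeff a p * mps_coeff b q * mps_coeff c r"
    have "mps_coeff (a * b * c) m
        = (\<Sum>(pq, r)\<in>splits m. \<Sum>(p, q)\<in>splits pq. ?f p q r)"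
      by (simp add: times_mps_def sum_distrib_right case_prod_unfold)
    also have "\<dots> = (\<Sum>(s, t)\<in>(SIGMA s:splits m. splits (fst s)). ?f (fst t) (snd t) (snd s))"
      by (subst sum.Sigma[symmetric]) (auto simp: case_prod_unfold)
    also have "\<dots> = (\<Sum>(s, t)\<in>(SIGMA s:splits m. splits (snd s)). ?f (fst s) (fst t) (snd t))"
      by (rule sum.reindex_bij_witness
            [where i = "\<lambda>((p, qr), (q, r)). ((p + q, r), (p, q))"
              and j = "\<lambda>((pq, r), (p, q)). ((p, q + r), (q, r))"])
         (auto simp: splits_def add.assoc)
    also have "\<dots> = (\<Sum>(p, qr)\<in>splits m. \<Sum>(q, r)\<in>splits qr. ?f p q r)"
      by (subst sum.Sigma[symmetric]) (auto simp: case_prod_unfold)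
    also have "\<dots> = mps_coeff (a * (b * c)) m"
      by (simp add: times_mps_def sum_distrib_left case_prod_unfold mult.assoc)
    finally show "mps_coeff (a * b * c) m = mps_coeff (a * (b * c)) m" .
  qed
  show "a * b = b * a"
  proof (rule mps_eqI)
    fix m
    show "mps_coeff (a * b) m = mps_coeff (b * a) m"
      unfolding times_mps_def mps_coeff_Abs
      by (rule sum.reindex_bij_witness[where i = prod.swap and j = prod.swap])
         (auto simp: splits_def add.commute mult.commute)
  qed
  show "1 * a = a"
  proof (rule mps_eqI)
    fix m
    have "mps_coeff (1 * a) m
        = (\<Sum>(p, q)\<in>splits m. (if p = 0 then 1 else 0) * mps_coeff a q)"
      by (simp add: times_mps_def one_mps_def)
    also have "\<dots> = (\<Sum>(p, q)\<in>{(0 :: 'a \<Rightarrow>\<^sub>0 nat, m)}. (if p = 0 then 1 else 0) * mps_coeff a q)"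
      by (rule sum.mono_neutral_right)
         (use finite_splits[of m] in \<open>auto simp: splits_def split: if_splits\<close>)
    finally show "mps_coeff (1 * a) m = mps_coeff a m" by simp
  qed
  show "(a + b) * c = a * c + b * c"
    by (rule mps_eqI)
       (simp add: times_mps_def plus_mps_def case_prod_unfold distrib_right sum.distrib)
  show "(0 :: ('a, 'b) mps) \<noteq> 1"
  proof
    assume "(0 :: ('a, 'b) mps) = 1"
    then have "mps_coeff (0 :: ('a, 'b) mps) 0 = mps_coeff 1 0" by simp
    then show False by (simp add: zero_mps_def one_mps_def)
  qed
  show "a + b + c = a + (b + c)"
    by (rule mps_eqI) (simp add: plus_mps_def add.assoc)
  show "a + b = b + a"
    by (rule mps_eqI) (simp add: plus_mps_def add.commute)
  show "0 + a = a"
    by (rule mps_eqI) (simp add: plus_mps_def zero_mps_def)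
  show "- a + a = 0"
    by (rule mps_eqI) (simp add: plus_mps_def zero_mps_def uminus_mps_def)
  show "a - b = a + - b"
    by (rule mps_eqI) (simp add: plus_mps_def minus_mps_def uminus_mps_def)
qed

end

definition mps_var :: "'i \<Rightarrow> ('i, 'a :: comm_ring_1) mps" where
  "mps_var z = Abs_mps (\<lambda>m. if m = Poly_Mapping.single z 1 then 1 else 0)"

text \<open>As usual, the reciprocal is only meaningful for units and set to 0 otherwise.\<close>

instantiation mps :: (type, comm_ring_1) inverse
begin

definition inverse_mps :: "('a, 'b) mps \<Rightarrow> ('a, 'b) mps" where
  "inverse_mps f = (if f dvd 1 then THE g. f * g = 1 else 0)"

definition divide_mps :: "('a, 'b) mps \<Rightarrow> ('a, 'b) mps \<Rightarrow> ('a, 'b) mps" where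
  "divide_mps f g = f * inverse g"

instance ..

end

lemma mps_inverse_eqI:
  fixes f g :: "('i, 'a :: comm_ring_1) mps"
  assumes "f * g = 1"
  shows "inverse f = g"
proof -
  have "h = g" if "f * h = 1" for h
  proof -
    have "h = (f * g) * h"
      by (simp only: assms mult_1)
    also have "\<dots> = (f * h) * g"
      by (simp only: mult.assoc mult.commute[of g h])
    also have "\<dots> = g"
      by (simp only: that mult_1)
    finally show ?thesis .
  qed
  then have "(THE h. f * h = 1) = g"
    using assms by (intro the_equality)
  moreover have "f dvd 1"
    using dvd_triv_left[of f g] by (simp only: assms)
  ultimately show ?thesis
    by (simp add: inverse_mps_def)
qed

text \<open>The topology of coefficientwise convergence, i.e. the product topology with discrete
  coefficients, see \<open>tendsto_mps_iff\<close>.\<close>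

instantiation mps :: (type, comm_ring_1) topological_space
begin

definition open_mps :: "('a, 'b) mps set \<Rightarrow> bool" where
  "open_mps U \<longleftrightarrow> (\<forall>f\<in>U. \<exists>S. finite S \<and>
     (\<forall>g. (\<forall>m\<in>S. mps_coeff g m = mps_coeff f m) \<longrightarrow> g \<in> U))"

instance
proof
  show "open (UNIV :: ('a, 'b) mps set)"
    by (auto simp: open_mps_def)
next
  fix S T :: "('a, 'b) mps set"
  assume S: "open S" and T: "open T"
  show "open (S \<inter> T)"
    unfolding open_mps_def
  proof
    fix f assume f: "f \<in> S \<inter> T"
    obtain A where A: "finite A" "\<And>g. \<forall>m\<in>A. mps_coeff g m = mps_coeff f m \<Longrightarrow> g \<in> S"
      using S f unfolding open_mps_def by blast
    obtain B where B: "finite B" "\<And>g. \<forall>m\<in>B. mps_coeff g m = mps_coeff f m \<Longrightarrow> g \<in> T"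
      using T f unfolding open_mps_def by blast
    show "\<exists>C. finite C \<and> (\<forall>g. (\<forall>m\<in>C. mps_coeff g m = mps_coeff f m) \<longrightarrow> g \<in> S \<inter> T)"
      by (rule exI[of _ "A \<union> B"]) (simp add: A B)
  qed
next
  fix K :: "('a, 'b) mps set set"
  assume K: "\<forall>S\<in>K. open S"
  show "open (\<Union>K)"
    unfolding open_mps_def
  proof
    fix f assume "f \<in> \<Union>K"
    then obtain S where S: "S \<in> K" "f \<in> S" by blast
    then obtain C where C: "finite C" "\<And>g. \<forall>m\<in>C. mps_coeff g m = mps_coeff f m \<Longrightarrow> g \<in> S"
      using K unfolding open_mps_def by meson
    show "\<exists>C. finite C \<and> (\<forall>g. (\<forall>m\<in>C. mps_coeff g m = mps_coeff f m) \<longrightarrow> g \<in> \<Union>K)"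
      by (rule exI[of _ C]) (use C S(1) in blast)
  qed
qed

end

lemma open_mps_cylinder: "open {f :: ('i, 'a :: comm_ring_1) mps. mps_coeff f m = c}"
  unfolding open_mps_def by (auto intro!: exI[of _ "{m}"])

instance mps :: (type, comm_ring_1) t2_space
proof
  fix f g :: "('a, 'b) mps"
  assume "f \<noteq> g"
  then obtain m where "mps_coeff f m \<noteq> mps_coeff g m"
    using mps_eqI by blast
  then show "\<exists>U V. open U \<and> open V \<and> f \<in> U \<and> g \<in> V \<and> U \<inter> V = {}"
    by (intro exI[of _ "{h. mps_coeff h m = mps_coeff f m}"]
          exI[of _ "{h. mps_coeff h m = mps_coeff g m}"])
       (simp add: open_mps_cylinder disjoint_iff)
qed

lemma tendsto_mps_iff:
  fixes l :: "('i, 'a :: comm_ring_1) mps"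
  shows "(f \<longlongrightarrow> l) F \<longleftrightarrow> (\<forall>m. \<forall>\<^sub>F k in F. mps_coeff (f k) m = mps_coeff l m)"
proof
  assume lim: "(f \<longlongrightarrow> l) F"
  show "\<forall>m. \<forall>\<^sub>F k in F. mps_coeff (f k) m = mps_coeff l m"
  proof
    fix m
    show "\<forall>\<^sub>F k in F. mps_coeff (f k) m = mps_coeff l m"
      using topological_tendstoD[OF lim open_mps_cylinder[of m "mps_coeff l m"]] by simp
  qed
next
  assume ev: "\<forall>m. \<forall>\<^sub>F k in F. mps_coeff (f k) m = mps_coeff l m"
  show "(f \<longlongrightarrow> l) F"
  proof (rule topological_tendstoI)
    fix U :: "('i, 'a) mps set"
    assume "open U" "l \<in> U"
    then obtain S where S: "finite S" "\<And>g. (\<forall>m\<in>S. mps_coeff g m = mps_coeff l m) \<Longrightarrow> g \<in> U"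
      unfolding open_mps_def by blast
    have "\<forall>\<^sub>F k in F. \<forall>m\<in>S. mps_coeff (f k) m = mps_coeff l m"
      using S(1) ev by (simp add: eventually_ball_finite)
    then show "\<forall>\<^sub>F k in F. f k \<in> U"
      by (rule eventually_mono) (rule S(2))
  qed
qed


section \<open>Schur polynomials\<close>

definition complete_sym :: "nat \<Rightarrow> (nat \<Rightarrow> 'a :: comm_ring_1) \<Rightarrow> int \<Rightarrow> 'a" where
  "complete_sym N x k = (if k < 0 then 0 else
     \<Sum>A | set_mset A \<subseteq> {1..N} \<and> size A = nat k. \<Prod>i\<in>#A. x i)"

text \<open>A partition is the list of its (positive) parts in weakly decreasing order, so the number
  of parts is the length of the list.\<close>

definition is_partition :: "nat list \<Rightarrow> bool" where
  "is_partition \<mu> \<longleftrightarrow> sorted_wrt (\<ge>) \<mu> \<and> (\<forall>k\<in>set \<mu>. 0 < k)"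

definition schur :: "nat \<Rightarrow> (nat \<Rightarrow> 'a :: comm_ring_1) \<Rightarrow> nat list \<Rightarrow> 'a" where
  "schur N x \<mu> = det (mat (length \<mu>) (length \<mu>)
     (\<lambda>(i, j). complete_sym N x (int (\<mu> ! i) - int i + int j)))"


section \<open>Charged free bosons\<close>

text \<open>\<open>vac\<close> is the vacuum and \<open>dvac\<close> the dual vacuum, regarded as a linear functional. The
  axioms determine \<open>dvac\<close> on the subspace generated from the vacuum by \<open>\<phi>\<close> and \<open>\<phi>s\<close>.\<close>

locale charged_free_bosons = vector_space scale
  for scale :: "'a :: field_char_0 \<Rightarrow> 'v :: ab_group_add \<Rightarrow> 'v" +
  fixes \<phi> \<phi>s :: "int \<Rightarrow> 'v \<Rightarrow> 'v"
    and vac :: 'v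
    and dvac :: "'v \<Rightarrow> 'a"
  assumes linear_\<phi>: "Vector_Spaces.linear scale scale (\<phi> i)"
    and linear_\<phi>s: "Vector_Spaces.linear scale scale (\<phi>s i)"
    and linear_dvac: "Vector_Spaces.linear scale (*) dvac"
    and comm_\<phi>_\<phi>s: "\<phi> i (\<phi>s j v) - \<phi>s j (\<phi> i v) = (if i = - j then v else 0)"
    and comm_\<phi>_\<phi>: "\<phi> i (\<phi> j v) - \<phi> j (\<phi> i v) = 0"
    and comm_\<phi>s_\<phi>s: "\<phi>s i (\<phi>s j v) - \<phi>s j (\<phi>s i v) = 0"
    and \<phi>_vac: "i \<ge> 0 \<Longrightarrow> \<phi> i vac = 0"
    and \<phi>s_vac: "i \<ge> 0 \<Longrightarrow> \<phi>s (i + 1) vac = 0"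
    and dvac_\<phi>: "i < 0 \<Longrightarrow> dvac (\<phi> i v) = 0"
    and dvac_\<phi>s: "i < 0 \<Longrightarrow> dvac (\<phi>s (i + 1) v) = 0"
    and dvac_vac: "dvac vac = 1"

subsection \<open>A model\<close>

text \<open>The axioms are satisfiable: in power series in variables \<open>X\<^sub>k\<close> with integer index, let
  \<open>\<phi> k\<close> and \<open>\<phi>s (- k)\<close> be multiplication by \<open>X\<^sub>k\<close> and minus its derivative for \<open>k < 0\<close>, and the
  derivative and the multiplication for \<open>k \<ge> 0\<close>. The vacuum is 1, the dual vacuum takes the
  constant coefficient, and the polynomials form the Fock space.\<close>

definition model_mult :: "int \<Rightarrow> (int, 'a :: field_char_0) mps \<Rightarrow> (int, 'a) mps" where
  "model_mult k f = Abs_mps (\<lambda>m. if Poly_Mapping.lookup m k = 0 then 0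
     else mps_coeff f (m - Poly_Mapping.single k 1))"

definition model_deriv :: "int \<Rightarrow> (int, 'a :: field_char_0) mps \<Rightarrow> (int, 'a) mps" where
  "model_deriv k f = Abs_mps (\<lambda>m. of_nat (Suc (Poly_Mapping.lookup m k)) *
     mps_coeff f (m + Poly_Mapping.single k 1))"

definition model_scale :: "'a \<Rightarrow> (int, 'a :: field_char_0) mps \<Rightarrow> (int, 'a) mps" where
  "model_scale c f = Abs_mps (\<lambda>m. c * mps_coeff f m)"

lemma model_comm:
  "model_mult j (model_mult k f) = model_mult k (model_mult j f)"
  "model_deriv j (model_deriv k f) = model_deriv k (model_deriv j f)"
  "model_deriv j (model_mult k f) = model_mult k (model_deriv j f) + (if j = k then f else 0)"
proof -
  have sub_comm: "m - Poly_Mapping.single a (Suc 0) - Poly_Mapping.single b (Suc 0)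
      = m - Poly_Mapping.single b (Suc 0) - Poly_Mapping.single a (Suc 0)"
    for m :: "int \<Rightarrow>\<^sub>0 nat" and a b
    by (rule poly_mapping_eqI) (simp add: lookup_minus)
  show "model_mult j (model_mult k f) = model_mult k (model_mult j f)"
    by (rule mps_eqI)
       (auto simp: model_mult_def lookup_minus lookup_single when_def sub_comm[of _ j k])
  show "model_deriv j (model_deriv k f) = model_deriv k (model_deriv j f)"
    by (rule mps_eqI)
       (auto simp: model_deriv_def lookup_add lookup_single when_def algebra_simps)
  show "model_deriv j (model_mult k f) = model_mult k (model_deriv j f) + (if j = k then f else 0)"
  proof (rule mps_eqI)
    fix m :: "int \<Rightarrow>\<^sub>0 nat"
    have sub: "m + Poly_Mapping.single j 1 - Poly_Mapping.single k 1
        = m - Poly_Mapping.single k 1 + Poly_Mapping.single j 1"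
      if "j \<noteq> k \<or> Poly_Mapping.lookup m k \<noteq> 0"
      using that by (intro poly_mapping_eqI)
        (auto simp: lookup_minus lookup_add lookup_single when_def)
    show "mps_coeff (model_deriv j (model_mult k f)) m
        = mps_coeff (model_mult k (model_deriv j f) + (if j = k then f else 0)) m"
    proof (cases "j = k")
      case True
      have readd: "m - Poly_Mapping.single k 1 + Poly_Mapping.single k 1 = m"
        if "Poly_Mapping.lookup m k \<noteq> 0"
        using that by (intro poly_mapping_eqI)
          (auto simp: lookup_minus lookup_add lookup_single when_def)
      show ?thesis
      proof (cases "Poly_Mapping.lookup m k = 0")
        case z: True
        then show ?thesis using True
          by (simp add: model_mult_def model_deriv_def lookup_add plus_mps_def)
      next
        case z: False
        then obtain n where "Poly_Mapping.lookup m k = Suc n"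
          using not0_implies_Suc by blast
        then show ?thesis using True readd[OF z]
          by (simp add: model_mult_def model_deriv_def lookup_add lookup_minus plus_mps_def
              algebra_simps)
      qed
    next
      case False
      then show ?thesis using sub
        by (auto simp: model_mult_def model_deriv_def lookup_add lookup_minus lookup_single
            plus_mps_def zero_mps_def when_def)
    qed
  qed
qed

lemma charged_free_bosons_model:
  "charged_free_bosons (model_scale :: 'a :: field_char_0 \<Rightarrow> _)
     (\<lambda>k. if k < 0 then model_mult k else model_deriv k)
     (\<lambda>j f. if - j < 0 then - model_deriv (- j) f else model_mult (- j) f)
     1 (\<lambda>f. mps_coeff f 0)"
proof -
  interpret V: vector_space "model_scale :: 'a \<Rightarrow> (int, 'a) mps \<Rightarrow> (int, 'a) mps"
    by unfold_locales
       (auto intro!: mps_eqI simp: model_scale_def plus_mps_def algebra_simps)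
  have vs: "vector_space ((*) :: 'a \<Rightarrow> 'a \<Rightarrow> 'a)"
    by unfold_locales (auto simp: algebra_simps)
  note vsV = V.vector_space_axioms
  have lin_m: "Vector_Spaces.linear model_scale model_scale (model_mult k :: _ \<Rightarrow> (int, 'a) mps)" for k
    by (auto intro!: mps_eqI vsV simp: Vector_Spaces.linear_iff model_scale_def model_mult_def plus_mps_def)
  have lin_d: "Vector_Spaces.linear model_scale model_scale (model_deriv k :: _ \<Rightarrow> (int, 'a) mps)" for k
    by (auto intro!: mps_eqI vsV simp: Vector_Spaces.linear_iff model_scale_def model_deriv_def plus_mps_def
        algebra_simps)
  have lin_d': "Vector_Spaces.linear model_scale model_scale (\<lambda>f. - model_deriv k f :: (int, 'a) mps)" for k
    by (auto intro!: mps_eqI vsV simp: Vector_Spaces.linear_iff model_scale_def model_deriv_def plus_mps_def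
        uminus_mps_def algebra_simps)
  have lin_c: "Vector_Spaces.linear model_scale (*) (\<lambda>f :: (int, 'a) mps. mps_coeff f 0)"
    by (auto intro!: vsV vs simp: Vector_Spaces.linear_iff model_scale_def plus_mps_def)
  have neg: "model_deriv k (- f) = - model_deriv k f" "model_mult k (- f) = - model_mult k f"
    for k and f :: "(int, 'a) mps"
    by (auto intro!: mps_eqI simp: model_deriv_def model_mult_def uminus_mps_def)
  have deriv_1: "model_deriv k (1 :: (int, 'a) mps) = 0" for k
  proof (rule mps_eqI)
    fix m :: "int \<Rightarrow>\<^sub>0 nat"
    have "Poly_Mapping.lookup (m + Poly_Mapping.single k 1) k \<noteq> 0"
      by (simp add: lookup_add)
    then have "m + Poly_Mapping.single k 1 \<noteq> 0"
      by (metis lookup_zero)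
    then show "mps_coeff (model_deriv k (1 :: (int, 'a) mps)) m = mps_coeff 0 m"
      by (simp add: model_deriv_def one_mps_def zero_mps_def)
  qed
  have mult_0: "mps_coeff (model_mult k f) 0 = 0" for k and f :: "(int, 'a) mps"
    by (simp add: model_mult_def)
  note comm = model_comm(1)[of _ _ "_ :: (int, 'a) mps"] model_comm(2)[of _ _ "_ :: (int, 'a) mps"]
    model_comm(3)[of _ _ "_ :: (int, 'a) mps"]
  let ?\<phi> = "\<lambda>k. if k < 0 then model_mult k else model_deriv k :: _ \<Rightarrow> (int, 'a) mps"
  let ?\<phi>s = "\<lambda>j f :: (int, 'a) mps. if - j < 0 then - model_deriv (- j) f else model_mult (- j) f"
  show ?thesis
  proof (intro charged_free_bosons.intro charged_free_bosons_axioms.intro vsV)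
    show "Vector_Spaces.linear model_scale model_scale (?\<phi> i)" for i
      by (cases "i < 0") (simp_all add: lin_m lin_d)
    show "Vector_Spaces.linear model_scale model_scale (?\<phi>s i)" for i
      by (cases "- i < 0") (simp_all only: lin_m lin_d' if_True if_False)
    show "?\<phi> i (?\<phi>s j v) - ?\<phi>s j (?\<phi> i v) = (if i = - j then v else 0)" for i j v
    proof -
      consider "i < 0" "- j < 0" | "i < 0" "\<not> - j < 0" | "\<not> i < 0" "- j < 0"
        | "\<not> i < 0" "\<not> - j < 0"
        by blast
      then show ?thesis
      proof cases
        case 1
        then show ?thesis by (simp add: neg comm(3))
      next
        case 2
        then have "i \<noteq> - j" by simp
        then show ?thesis using 2 by (simp add: comm(1)[of i "- j"])
      next
        case 3
        then have "i \<noteq> - j" by simp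
        then show ?thesis using 3 by (simp add: neg comm(2)[of i "- j"])
      next
        case 4
        then show ?thesis by (simp add: comm(3))
      qed
    qed
    show "?\<phi> i (?\<phi> j v) - ?\<phi> j (?\<phi> i v) = 0" for i j v
      by (simp add: comm(1)[of i j] comm(2)[of i j] comm(3))
    show "?\<phi>s i (?\<phi>s j v) - ?\<phi>s j (?\<phi>s i v) = 0" for i j v
      by (simp add: neg comm(1)[of "- i" "- j"] comm(2)[of "- i" "- j"] comm(3))
    show "mps_coeff (1 :: (int, 'a) mps) 0 = 1"
      by (simp add: one_mps_def)
  qed (simp_all add: lin_c deriv_1 mult_0)
qed

subsection \<open>Power series with operator coefficients\<close>

type_synonym ('i, 'v) opser = "('i \<Rightarrow>\<^sub>0 nat) \<Rightarrow> 'v \<Rightarrow> 'v"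

definition op_one :: "('i, 'v :: zero) opser" where
  "op_one m v = (if m = 0 then v else 0)"

definition op_mult :: "('i, 'v :: comm_monoid_add) opser \<Rightarrow> ('i, 'v) opser \<Rightarrow> ('i, 'v) opser" where
  "op_mult P Q m v = (\<Sum>(p, q)\<in>splits m. P p (Q q v))"

definition op_prod :: "('i, 'v :: comm_monoid_add) opser list \<Rightarrow> ('i, 'v) opser" where
  "op_prod Ps = foldr op_mult Ps op_one"

definition op_exp :: "('a :: field_char_0 \<Rightarrow> 'v \<Rightarrow> 'v) \<Rightarrow> 'i \<Rightarrow> ('v \<Rightarrow> 'v :: zero) \<Rightarrow> ('i, 'v) opser" where
  \<comment> \<open>\<open>exp (z A)\<close> as a series in the variable \<open>z\<close>\<close>
  "op_exp sc z A m v = (let n = Poly_Mapping.lookup m z in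
     if m = Poly_Mapping.single z n then sc (1 / fact n) ((A ^^ n) v) else 0)"

text \<open>Infinite products are limits of finite ones: each coefficient, applied to a fixed vector,
  is eventually constant. For the products below this is the case on every vector that is
  killed by all but finitely many \<open>\<phi> i\<close> and \<open>\<phi>s i\<close> with \<open>i \<ge> 0\<close>, in particular on
  everything generated from the vacuum.\<close>

definition op_lim :: "(nat \<Rightarrow> ('i, 'v) opser) \<Rightarrow> ('i, 'v) opser" where
  "op_lim P m v = (THE w. \<forall>\<^sub>F K in sequentially. P K m v = w)"

text \<open>In both definitions the \<open>k\<close>-th factor is the one with \<open>i = M - k\<close>.\<close>

definition Bstar ::
  "('a :: field_char_0 \<Rightarrow> 'v \<Rightarrow> 'v) \<Rightarrow> (int \<Rightarrow> 'v \<Rightarrow> 'v) \<Rightarrow> (int \<Rightarrow> 'v \<Rightarrow> 'v) \<Rightarrow> nat \<Rightarrow> 'i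
    \<Rightarrow> ('i, 'v :: comm_monoid_add) opser" where
  "Bstar sc \<phi> \<phi>s M z = op_lim (\<lambda>K. op_prod
     (map (\<lambda>k. let i = int M - int k in op_exp sc z (\<lambda>v. \<phi> (- i) (\<phi>s (i - 1) v))) [0..<K]))"

definition Cstar ::
  "('a :: field_char_0 \<Rightarrow> 'v \<Rightarrow> 'v) \<Rightarrow> (int \<Rightarrow> 'v \<Rightarrow> 'v) \<Rightarrow> (int \<Rightarrow> 'v \<Rightarrow> 'v) \<Rightarrow> nat \<Rightarrow> 'i
    \<Rightarrow> ('i, 'v :: comm_monoid_add) opser" where
  "Cstar sc \<phi> \<phi>s M z = op_lim (\<lambda>K. op_prod
     (map (\<lambda>k. let i = int M - int k in op_exp sc z (\<lambda>v. \<phi> (- i + 1) (\<phi>s i v))) (rev [0..<K])))"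

definition vev :: "'v \<Rightarrow> ('v \<Rightarrow> 'a) \<Rightarrow> ('i, 'v) opser \<Rightarrow> ('i, 'a) mps" where
  "vev vac dvac P = Abs_mps (\<lambda>m. dvac (P m vac))"

datatype xy_var = Xvar nat | Yvar nat

definition correlator ::
  "('a :: field_char_0 \<Rightarrow> 'v \<Rightarrow> 'v) \<Rightarrow> (int \<Rightarrow> 'v \<Rightarrow> 'v) \<Rightarrow> (int \<Rightarrow> 'v \<Rightarrow> 'v) \<Rightarrow> 'v :: comm_monoid_add
    \<Rightarrow> ('v \<Rightarrow> 'a) \<Rightarrow> nat \<Rightarrow> nat \<Rightarrow> (xy_var, 'a) mps" where
  "correlator sc \<phi> \<phi>s vac dvac M N = vev vac dvac (op_prod
     (map (\<lambda>i. Cstar sc \<phi> \<phi>s M (Xvar i)) (rev [1..<N + 1]) @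
      map (\<lambda>i. Bstar sc \<phi> \<phi>s M (Yvar i)) [1..<N + 1]))"

end

theory Submission
  imports Defs
begin

text \<open>Put \<open>a\<^sub>i = \<phi>\<^sub>-\<^sub>i\<close> and \<open>b\<^sub>i = \<phi>\<^sup>*\<^sub>i\<close>, so that \<open>[a\<^sub>i, b\<^sub>j] = \<delta>\<^sub>i\<^sub>j\<close>; the vacuum is killed by \<open>a\<^sub>i\<close> for
\<open>i \<le> 0\<close> and by \<open>b\<^sub>i\<close> for \<open>i \<ge> 1\<close>, the dual vacuum by \<open>b\<^sub>i\<close> for \<open>i \<le> 0\<close> and by \<open>a\<^sub>i\<close> for \<open>i \<ge> 1\<close>.
Both infinite products consist of factors \<open>exp (z a\<^sub>p b\<^sub>q)\<close> with \<open>p = q \<plusminus> 1\<close>. A factor with very negative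
indices acts trivially on every vector that occurs, and only the factors with \<open>p\<close> and \<open>q\<close> in
\<open>{1 - N..M}\<close> remain (\<open>correlator_eq_word\<close>). The correlator is therefore the vacuum expectation value of a
finite word in such exponentials.

For a word \<open>W\<close> let \<open>L \<Psi> = \<langle>0|W \<Psi>\<rangle>\<close>. If \<open>b\<^sub>k\<close> with \<open>k \<le> 0\<close> is moved through \<open>W\<close> from the left, where the
dual vacuum kills it, the result is a relation \<open>\<Sum>\<^sub>j S k j * L (b\<^sub>j \<Psi>) = 0\<close>. With \<open>j\<close> as the row index of \<open>S\<close>,
appending \<open>exp (z a\<^sub>p b\<^sub>q)\<close> on the right is a row operation: \<open>z\<close> times row \<open>p\<close> is subtracted from row \<open>q\<close>.
The heart of the proof is that \<open>det T * L |0\<rangle> = 1\<close> for every word, where \<open>T\<close> is the block of \<open>S\<close> with \<open>k\<close> and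
\<open>j\<close> in \<open>{1 - N..0}\<close> (\<open>row_invariant_word\<close>). Only a factor with \<open>p \<ge> 1\<close> and
\<open>q \<le> 0\<close> changes either side. For it, \<open>exp (z a\<^sub>p b\<^sub>q)|0\<rangle> = |0\<rangle> + z b\<^sub>q \<Phi>\<close> for a series \<open>\<Phi>\<close> on which the
\<open>b\<^sub>j\<close> with \<open>j \<ge> 1\<close> are known; the relations then form a linear system for the \<open>L (b\<^sub>j \<Phi>)\<close> with \<open>j \<le> 0\<close>, and
Cramer's rule shows that \<open>L\<close> and the determinant change by reciprocal factors.

For the word at hand the row operations produce complete symmetric polynomials, because
\<open>h\<^sub>k(x\<^sub>1,\<dots>,x\<^sub>r) - x\<^sub>r h\<^sub>k\<^sub>-\<^sub>1(x\<^sub>1,\<dots>,x\<^sub>r) = h\<^sub>k(x\<^sub>1,\<dots>,x\<^sub>r\<^sub>-\<^sub>1)\<close>. Up to signs that cancel, the block is the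
\<open>N \<times> N\<close> matrix with entries \<open>\<Sum>\<^sub>s h\<^sub>s\<^sub>+\<^sub>i(y) h\<^sub>s\<^sub>+\<^sub>j(x)\<close>, where \<open>s\<close> runs over \<open>{1 - N..M}\<close>. The Cauchy--Binet
formula expands its determinant over the decreasing sequences \<open>s\<^sub>i = \<mu>\<^sub>i - i\<close>, that is, over the partitions
\<open>\<mu>\<close> in the \<open>N \<times> M\<close> box, and the minors are Schur polynomials (\<open>schur_sum_eq_det\<close>).

For \<open>M \<rightarrow> \<infinity>\<close> the entries converge coefficientwise. In the limit the matrix for \<open>r\<close> variables \<open>x\<close>,
multiplied by \<open>1 - x\<^sub>r K\<close> with \<open>K\<close> the companion matrix of \<open>\<Prod>\<^sub>j (t - y\<^sub>j)\<close>, becomes the matrix for \<open>r - 1\<close>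
variables. As \<open>det (1 - x\<^sub>r K) = \<Prod>\<^sub>j (1 - x\<^sub>r y\<^sub>j)\<close>, this yields Cauchy's identity without any division
(\<open>cauchy_identity_limit\<close>), and it passes to the reciprocals.\<close>

section \<open>Determinants\<close>

lemma det_mat_eq:
  "det (mat n n A) = (\<Sum>p | p permutes {0..<n}. signof p * (\<Prod>i=0..<n. A (i, p i)))"
proof -
  have "(\<Prod>i=0..<n. mat n n A $$ (i, p i)) = (\<Prod>i=0..<n. A (i, p i))"
    if "p permutes {0..<n}" for p
    using permutes_in_image[OF that] by (intro prod.cong) auto
  then show ?thesis
    by (subst det_def'[of _ n]) (auto intro!: sum.cong)
qed

text \<open>This is what turns the multilinear expansion of a determinant into a sum over minors: an injective choice of
columns is a decreasing sequence together with the order in which its entries are chosen.\<close>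

lemma bij_betw_sorted_permutation:
  fixes T :: "'s :: linorder set"
  shows "bij_betw (\<lambda>(ds, p). restrict (\<lambda>i. ds ! p i) {0..<n})
    ({ds. sorted_wrt (>) ds \<and> length ds = n \<and> set ds \<subseteq> T} \<times> {p. p permutes {0..<n}})
    {f \<in> {0..<n} \<rightarrow>\<^sub>E T. inj_on f {0..<n}}"
proof (rule bij_betw_imageI)
  let ?D = "{ds. sorted_wrt (>) ds \<and> length ds = n \<and> set ds \<subseteq> T}"
  have sorted: "sorted_wrt (<) (rev ds)" if "sorted_wrt (>) ds" for ds :: "'s list"
    using that by (simp add: sorted_wrt_rev)
  have dist: "distinct ds" if "sorted_wrt (>) ds" for ds :: "'s list"
    using sorted[OF that] by (metis distinct_rev strict_sorted_iff)
  have img: "(\<lambda>i. ds ! p i) ` {0..<n} = set ds" if "length ds = n" "p permutes {0..<n}"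
    for ds :: "'s list" and p
  proof -
    have "(\<lambda>i. ds ! p i) ` {0..<n} = (!) ds ` (p ` {0..<n})"
      by (simp add: image_image)
    then show ?thesis
      using that by (simp add: permutes_image set_conv_nth) auto
  qed
  show "inj_on (\<lambda>(ds, p). restrict (\<lambda>i. ds ! p i) {0..<n}) (?D \<times> {p. p permutes {0..<n}})"
  proof (rule inj_onI, clarify, rule conjI)
    fix ds p ds' p'
    assume ds: "sorted_wrt (>) ds" "n = length ds" and p: "p permutes {0..<length ds}"
      and ds': "sorted_wrt (>) ds'" "length ds' = length ds" and p': "p' permutes {0..<length ds}"
      and eq: "(\<lambda>i\<in>{0..<length ds}. ds ! p i) = (\<lambda>i\<in>{0..<length ds}. (ds' :: 's list) ! p' i)"
    have eq': "ds ! p i = ds' ! p' i" if "i \<in> {0..<length ds}" for i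
      using fun_cong[OF eq, of i] that by simp
    have "set ds = (\<lambda>i. ds ! p i) ` {0..<length ds}"
      using img[of ds p] ds p by simp
    also have "\<dots> = (\<lambda>i. ds' ! p' i) ` {0..<length ds}"
      using eq' by (intro image_cong) auto
    also have "\<dots> = set ds'"
      using img[of ds' p'] ds ds' p' by simp
    finally have "rev ds = rev ds'"
      using sorted[OF ds(1)] sorted[OF ds'(1)] by (intro strict_sorted_equal) auto
    then show dd: "ds = ds'" by simp
    show "p = p'"
    proof (rule ext)
      fix i
      show "p i = p' i"
      proof (cases "i \<in> {0..<length ds}")
        case True
        then have "p i < length ds" "p' i < length ds"
          using permutes_in_image[OF p] permutes_in_image[OF p'] by auto
        then show ?thesis
          using eq'[OF True] dd dist[OF ds(1)] by (simp add: nth_eq_iff_index_eq)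
      next
        case False
        then show ?thesis using p p' by (metis permutes_not_in)
      qed
    qed
  qed
  show "(\<lambda>(ds, p). restrict (\<lambda>i. ds ! p i) {0..<n}) ` (?D \<times> {p. p permutes {0..<n}})
      = {f \<in> {0..<n} \<rightarrow>\<^sub>E T. inj_on f {0..<n}}" (is "?l = ?r")
  proof
    show "?l \<subseteq> ?r"
    proof (clarify, rule conjI)
      fix ds p
      assume ds: "sorted_wrt (>) ds" "n = length ds" "set ds \<subseteq> T" and p: "p permutes {0..<length ds}"
      have m: "p i < length ds" if "i < length ds" for i
        using permutes_in_image[OF p, of i] that by simp
      show "(\<lambda>i\<in>{0..<length ds}. ds ! p i) \<in> {0..<length ds} \<rightarrow>\<^sub>E T"
        using m ds by (auto simp: subset_iff)
      show "inj_on (\<lambda>i\<in>{0..<length ds}. ds ! p i) {0..<length ds}"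
        using m dist[OF ds(1)] permutes_inj[OF p]
        by (auto simp: inj_on_def nth_eq_iff_index_eq dest: injD)
    qed
    show "?r \<subseteq> ?l"
    proof
      fix f assume "f \<in> ?r"
      then have f: "f \<in> {0..<n} \<rightarrow>\<^sub>E T" and inj: "inj_on f {0..<n}" by auto
      define ds where "ds = rev (sorted_list_of_set (f ` {0..<n}))"
      have ds: "set ds = f ` {0..<n}" "length ds = n" "sorted_wrt (>) ds"
        using inj by (simp_all add: ds_def card_image sorted_wrt_rev)
      have bij: "bij_betw ((!) ds) {0..<n} (f ` {0..<n})"
        using bij_betw_nth[OF dist[OF ds(3)], of "{0..<n}" "f ` {0..<n}"] ds
        by (simp add: lessThan_atLeast0)
      define p where "p = (\<lambda>i. if i \<in> {0..<n} then inv_into {0..<n} ((!) ds) (f i) else i)"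
      have "bij_betw (inv_into {0..<n} ((!) ds) \<circ> f) {0..<n} {0..<n}"
        using bij_betw_trans[OF _ bij_betw_inv_into[OF bij], of f] inj
        by (simp add: bij_betw_def)
      then have "bij_betw p {0..<n} {0..<n}"
        by (rule iffD1[OF bij_betw_cong, rotated]) (simp add: p_def)
      then have p: "p permutes {0..<n}"
        by (rule bij_imp_permutes) (simp add: p_def)
      have "ds ! p i = f i" if "i \<in> {0..<n}" for i
        using that bij_betw_inv_into_right[OF bij, of "f i"] by (simp add: p_def)
      then have "f = (case (ds, p) of (ds, p) \<Rightarrow> restrict (\<lambda>i. ds ! p i) {0..<n})"
        using f by (auto simp: fun_eq_iff PiE_arb[of f])
      moreover have "(ds, p) \<in> ?D \<times> {p. p permutes {0..<n}}" using ds f p by auto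
      ultimately show "f \<in> ?l" by (rule image_eqI)
    qed
  qed
qed

text \<open>Expanding the product over the rows gives a sum over all maps from the rows into \<open>T\<close>. Maps that are not
injective contribute determinants with two equal rows. The others are grouped by their sorted image, and
the sum over the permutations of one image is again a determinant.\<close>

theorem cauchy_binet:
  fixes A B :: "nat \<Rightarrow> 's :: linorder \<Rightarrow> 'r :: comm_ring_1"
  assumes T: "finite T"
  shows "det (mat n n (\<lambda>(i, j). \<Sum>s\<in>T. A i s * B j s)) =
    (\<Sum>ds | sorted_wrt (>) ds \<and> length ds = n \<and> set ds \<subseteq> T.
       det (mat n n (\<lambda>(i, j). A j (ds ! i))) * det (mat n n (\<lambda>(i, j). B j (ds ! i))))"
proof -
  let ?P = "{p. p permutes {0..<n}}"
  let ?F = "{0..<n} \<rightarrow>\<^sub>E T"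
  let ?I = "{f \<in> ?F. inj_on f {0..<n}}"
  let ?D = "{ds. sorted_wrt (>) ds \<and> length ds = n \<and> set ds \<subseteq> T}"
  define G where "G f = (\<Prod>i=0..<n. A i (f i)) * det (mat n n (\<lambda>(i, j). B j (f i)))" for f
  have "det (mat n n (\<lambda>(i, j). \<Sum>s\<in>T. A i s * B j s))
      = (\<Sum>p\<in>?P. signof p * (\<Prod>i=0..<n. \<Sum>s\<in>T. A i s * B (p i) s))"
    by (simp add: det_mat_eq)
  also have "\<dots> = (\<Sum>p\<in>?P. signof p * (\<Sum>f\<in>?F. \<Prod>i=0..<n. A i (f i) * B (p i) (f i)))"
    using T by (simp add: prod_sum_PiE)
  also have "\<dots> = (\<Sum>p\<in>?P. \<Sum>f\<in>?F. (\<Prod>i=0..<n. A i (f i)) * (signof p * (\<Prod>i=0..<n. B (p i) (f i))))"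
    by (simp add: sum_distrib_left prod.distrib mult_ac)
  also have "\<dots> = (\<Sum>f\<in>?F. G f)"
    by (subst sum.swap) (simp add: G_def det_mat_eq sum_distrib_left)
  also have "\<dots> = (\<Sum>f\<in>?I. G f)"
  proof (rule sum.mono_neutral_right)
    show "\<forall>f\<in>?F - ?I. G f = 0"
    proof
      fix f assume "f \<in> ?F - ?I"
      then obtain i j where ij: "i < n" "j < n" "i \<noteq> j" "f i = f j"
        by (auto simp: inj_on_def)
      have "det (mat n n (\<lambda>(i, j). B j (f i))) = 0"
        by (rule det_identical_rows[of _ n i j]) (use ij in \<open>auto intro!: eq_vecI\<close>)
      then show "G f = 0" by (simp add: G_def)
    qed
  qed (use T in \<open>auto intro!: finite_PiE\<close>)
  also have "\<dots> = (\<Sum>(ds, p)\<in>?D \<times> ?P. G (restrict (\<lambda>i. ds ! p i) {0..<n}))"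
    by (subst sum.reindex_bij_betw[OF bij_betw_sorted_permutation, symmetric])
       (auto intro!: sum.cong)
  also have "\<dots> = (\<Sum>ds\<in>?D. \<Sum>p\<in>?P. G (restrict (\<lambda>i. ds ! p i) {0..<n}))"
    by (simp add: sum.cartesian_product)
  also have "\<dots> = (\<Sum>ds\<in>?D. det (mat n n (\<lambda>(i, j). A j (ds ! i))) * det (mat n n (\<lambda>(i, j). B j (ds ! i))))"
  proof (rule sum.cong[OF refl])
    fix ds assume ds: "ds \<in> ?D"
    have G: "G (restrict (\<lambda>i. ds ! p i) {0..<n}) =
        signof p * (\<Prod>i=0..<n. A i (ds ! p i)) * det (mat n n (\<lambda>(i, j). B j (ds ! i)))"
      if p: "p \<in> ?P" for p
    proof -
      have m: "p i < n" if "i < n" for i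
        using p permutes_in_image[of p "{0..<n}" i] that by auto
      have "mat n n (\<lambda>(i, j). B j (restrict (\<lambda>i. ds ! p i) {0..<n} i))
          = mat n n (\<lambda>(i, j). mat n n (\<lambda>(i, j). B j (ds ! i)) $$ (p i, j))"
        using m by (intro eq_matI) auto
      then have "det (mat n n (\<lambda>(i, j). B j (restrict (\<lambda>i. ds ! p i) {0..<n} i)))
          = signof p * det (mat n n (\<lambda>(i, j). B j (ds ! i)))"
        using det_permute_rows[of "mat n n (\<lambda>(i, j). B j (ds ! i))" n p] p by simp
      then show ?thesis by (simp add: G_def mult_ac)
    qed
    have "(\<Sum>p\<in>?P. G (restrict (\<lambda>i. ds ! p i) {0..<n}))
        = (\<Sum>p\<in>?P. signof p * (\<Prod>i=0..<n. A i (ds ! p i))) * det (mat n n (\<lambda>(i, j). B j (ds ! i)))"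
      by (simp add: G sum_distrib_right)
    also have "(\<Sum>p\<in>?P. signof p * (\<Prod>i=0..<n. A i (ds ! p i))) = det (mat n n (\<lambda>(i, j). A i (ds ! j)))"
      by (simp add: det_mat_eq)
    also have "\<dots> = det (mat n n (\<lambda>(i, j). A j (ds ! i)))"
    proof -
      have "(mat n n (\<lambda>(i, j). A i (ds ! j)))\<^sup>T = mat n n (\<lambda>(i, j). A j (ds ! i))"
        by (intro eq_matI) auto
      then show ?thesis
        using det_transpose[of "mat n n (\<lambda>(i, j). A i (ds ! j))" n] by simp
    qed
    finally show "(\<Sum>p\<in>?P. G (restrict (\<lambda>i. ds ! p i) {0..<n}))
        = det (mat n n (\<lambda>(i, j). A j (ds ! i))) * det (mat n n (\<lambda>(i, j). B j (ds ! i)))" .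
  qed
  finally show ?thesis .
qed

text \<open>The coefficients \<open>c\<close> are the cofactors of row \<open>q\<close>, which do not depend on that row.\<close>

lemma det_row_linear:
  fixes A :: "nat \<Rightarrow> nat \<Rightarrow> 'r :: comm_ring_1"
  assumes "q < n"
  obtains c where "\<And>r. det (mat n n (\<lambda>(i, k). if i = q then r k else A i k)) = (\<Sum>k<n. r k * c k)"
proof (rule that[of "cofactor (mat n n (\<lambda>(i, k). if i = q then 0 else A i k)) q"])
  fix r :: "nat \<Rightarrow> 'r"
  let ?B = "\<lambda>r. mat n n (\<lambda>(i, k). if i = q then r k else A i k)"
  have "mat_delete (?B r) q k = mat_delete (?B (\<lambda>_. 0)) q k" if "k < n" for k
    using that assms by (intro eq_matI) (auto simp: mat_delete_def)
  then have "cofactor (?B r) q k = cofactor (?B (\<lambda>_. 0)) q k" if "k < n" for k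
    using that by (simp add: cofactor_def)
  then show "det (?B r) = (\<Sum>k<n. r k * cofactor (?B (\<lambda>_. 0)) q k)"
    using assms by (subst laplace_expansion_row[of _ n q]) auto
qed

lemma det_add_other_row:
  fixes A :: "nat \<Rightarrow> nat \<Rightarrow> 'r :: comm_ring_1"
  assumes "q < n" "p < n" "p \<noteq> q"
  shows "det (mat n n (\<lambda>(i, k). if i = q then A i k - z * A p k else A i k))
    = det (mat n n (\<lambda>(i, k). A i k))"
proof -
  have "mat n n (\<lambda>(i, k). if i = q then A i k - z * A p k else A i k)
      = addrow (- z) q p (mat n n (\<lambda>(i, k). A i k))"
    using assms by (intro eq_matI) auto
  then show ?thesis
    using assms by (simp add: det_addrow[of _ n])
qed

text \<open>A form of Cramer's rule that avoids dividing by the determinant. The hypothesis is a linear system for \<open>v\<close>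
with right-hand side \<open>w * r\<close>; paired with the cofactors of row \<open>q\<close> it gives
\<open>w * det (A with row q replaced by r) = v q * det A\<close>.\<close>

lemma det_replace_row_solution:
  fixes A :: "nat \<Rightarrow> nat \<Rightarrow> 'r :: comm_ring_1"
  assumes q: "q < n" and eq: "\<And>k. k < n \<Longrightarrow> (\<Sum>i<n. A i k * v i) = r k * w"
  shows "det (mat n n (\<lambda>(i, k). if i = q then A i k - z * r k else A i k)) * w
    = det (mat n n (\<lambda>(i, k). A i k)) * (w - z * v q)"
proof -
  obtain c where c: "\<And>r. det (mat n n (\<lambda>(i, k). if i = q then r k else A i k)) = (\<Sum>k<n. r k * c k)"
    using det_row_linear[OF q] by blast
  let ?d = "det (mat n n (\<lambda>(i, k). A i k))"
  have row: "(\<Sum>k<n. A i k * c k) = (if i = q then ?d else 0)" if i: "i < n" for i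
  proof (cases "i = q")
    case True
    have "mat n n (\<lambda>(i, k). if i = q then A q k else A i k) = mat n n (\<lambda>(i, k). A i k)"
      by (intro eq_matI) auto
    then show ?thesis using c[of "A q"] True by simp
  next
    case False
    have "det (mat n n (\<lambda>(i', k). if i' = q then A i k else A i' k)) = 0"
      by (rule det_identical_rows[of _ n i q]) (use i q False in \<open>auto intro!: eq_vecI\<close>)
    then show ?thesis using c[of "A i"] False by simp
  qed
  have "mat n n (\<lambda>(i, k). if i = q then A i k - z * r k else A i k)
      = mat n n (\<lambda>(i, k). if i = q then A q k - z * r k else A i k)"
    by (intro eq_matI) auto
  then have "det (mat n n (\<lambda>(i, k). if i = q then A i k - z * r k else A i k)) * w
      = (\<Sum>k<n. (A q k - z * r k) * c k) * w"
    using c[of "\<lambda>k. A q k - z * r k"] by simp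
  also have "\<dots> = (\<Sum>k<n. A q k * c k) * w - z * (\<Sum>k<n. (r k * w) * c k)"
    by (simp add: algebra_simps sum_subtractf sum_distrib_left sum_distrib_right)
  also have "(\<Sum>k<n. (r k * w) * c k) = (\<Sum>k<n. (\<Sum>i<n. A i k * v i) * c k)"
    using eq by simp
  also have "\<dots> = (\<Sum>k<n. \<Sum>i<n. v i * (A i k * c k))"
    by (simp add: sum_distrib_left mult_ac)
  also have "\<dots> = (\<Sum>i<n. v i * (\<Sum>k<n. A i k * c k))"
    by (subst sum.swap) (simp add: sum_distrib_left)
  also have "\<dots> = (\<Sum>i<n. if i = q then v i * ?d else 0)"
    by (rule sum.cong) (auto simp: row)
  also have "\<dots> = v q * ?d"
    using q by simp
  finally show ?thesis
    using row[OF q] by (simp add: algebra_simps)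
qed

lemma det_last_row_unit:
  fixes A :: "nat \<Rightarrow> nat \<Rightarrow> 'r :: comm_ring_1"
  assumes "\<And>j. j < n \<Longrightarrow> A n j = 0" "A n n = 1"
  shows "det (mat (Suc n) (Suc n) (\<lambda>(i, j). A i j)) = det (mat n n (\<lambda>(i, j). A i j))"
proof -
  let ?A = "mat (Suc n) (Suc n) (\<lambda>(i, j). A i j)"
  have del: "mat_delete ?A n n = mat n n (\<lambda>(i, j). A i j)"
    by (intro eq_matI) (auto simp: mat_delete_def)
  have "det ?A = (\<Sum>j<Suc n. ?A $$ (n, j) * cofactor ?A n j)"
    by (rule laplace_expansion_row) auto
  also have "\<dots> = cofactor ?A n n"
    using assms by simp
  also have "\<dots> = det (mat n n (\<lambda>(i, j). A i j))"
    by (simp only: cofactor_def del) simp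
  finally show ?thesis .
qed

section \<open>Schur polynomials as minors\<close>

text \<open>The complete symmetric polynomial in an arbitrary set of variables, so that variables can be added one at a
time.\<close>

definition hsym :: "nat set \<Rightarrow> (nat \<Rightarrow> 'r :: comm_ring_1) \<Rightarrow> int \<Rightarrow> 'r" where
  "hsym V x k = (if k < 0 then 0 else
     \<Sum>A | set_mset A \<subseteq> V \<and> size A = nat k. \<Prod>i\<in>#A. x i)"

lemma complete_sym_eq_hsym: "complete_sym N = hsym {1..N}"
  by (simp add: fun_eq_iff complete_sym_def hsym_def)

lemma hsym_neg [simp]: "k < 0 \<Longrightarrow> hsym V x k = 0"
  by (simp add: hsym_def)

lemma hsym_0 [simp]: "hsym V x 0 = 1"
proof -
  have "{A :: nat multiset. set_mset A \<subseteq> V \<and> size A = 0} = {{#}}" by auto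
  then show ?thesis by (simp add: hsym_def)
qed

lemma hsym_empty: "hsym {} x k = (if k = 0 then 1 else 0)"
proof (cases "k > 0")
  case True
  then have "{A :: nat multiset. set_mset A \<subseteq> {} \<and> size A = nat k} = {}" by auto
  then show ?thesis using True by (simp only: hsym_def) auto
next
  case False
  then show ?thesis by (cases "k = 0") auto
qed

lemma finite_multisets_of_size:
  assumes "finite V"
  shows "finite {A. set_mset A \<subseteq> V \<and> size A = n}"
proof (rule finite_subset)
  show "{A. set_mset A \<subseteq> V \<and> size A = n} \<subseteq> mset ` {xs. set xs \<subseteq> V \<and> length xs = n}"
  proof
    fix A assume A: "A \<in> {A. set_mset A \<subseteq> V \<and> size A = n}"
    obtain xs where "mset xs = A" using ex_mset by blast
    then show "A \<in> mset ` {xs. set xs \<subseteq> V \<and> length xs = n}"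
      using A by (intro image_eqI[of _ _ xs]) auto
  qed
  show "finite (mset ` {xs. set xs \<subseteq> V \<and> length xs = n})"
    using finite_lists_length_eq[OF assms] by blast
qed

text \<open>The multisets that contain \<open>v\<close> are those of one element less with \<open>v\<close> added. All later computations with
complete symmetric polynomials rest on this recursion.\<close>

lemma hsym_insert:
  assumes V: "finite V" "v \<notin> V"
  shows "hsym (insert v V) x k - x v * hsym (insert v V) x (k - 1) = hsym V x k"
proof (cases "k \<le> 0")
  case True
  then show ?thesis by (cases "k = 0") auto
next
  case False
  then obtain n where n: "k = int (Suc n)"
    by (metis not_le zero_less_imp_eq_int gr0_implies_Suc)
  let ?m = "\<lambda>A. \<Prod>i\<in>#A. x i"
  let ?S = "\<lambda>V n. {A. set_mset A \<subseteq> V \<and> size A = n}"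
  have split: "?S (insert v V) (Suc n) = ?S V (Suc n) \<union> add_mset v ` ?S (insert v V) n"
  proof (intro equalityI subsetI)
    fix A assume A: "A \<in> ?S (insert v V) (Suc n)"
    show "A \<in> ?S V (Suc n) \<union> add_mset v ` ?S (insert v V) n"
    proof (cases "v \<in># A")
      case True
      then obtain B where "A = add_mset v B" by (metis insert_DiffM)
      then show ?thesis using A by auto
    next
      case False
      then show ?thesis using A by auto
    qed
  qed auto
  have "(\<Sum>A\<in>?S (insert v V) (Suc n). ?m A)
      = (\<Sum>A\<in>?S V (Suc n). ?m A) + (\<Sum>A\<in>add_mset v ` ?S (insert v V) n. ?m A)"
    unfolding split using V by (intro sum.union_disjoint) (auto simp: finite_multisets_of_size)
  also have "(\<Sum>A\<in>add_mset v ` ?S (insert v V) n. ?m A) = x v * (\<Sum>A\<in>?S (insert v V) n. ?m A)"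
    by (subst sum.reindex) (auto simp: sum_distrib_left inj_on_def)
  finally show ?thesis
    by (simp add: hsym_def n nat_add_distrib)
qed

definition pad :: "nat list \<Rightarrow> nat \<Rightarrow> nat" where
  "pad \<mu> i = (if i < length \<mu> then \<mu> ! i else 0)"

text \<open>Padding a partition by zeros adds to the Jacobi--Trudi matrix rows that vanish to the left of the diagonal
entry 1.\<close>

lemma schur_eq_padded_det:
  assumes "length \<mu> \<le> n"
  shows "schur N x \<mu> = det (mat n n (\<lambda>(i, j). complete_sym N x (int (pad \<mu> i) - int i + int j)))"
  using assms
proof (induction n rule: dec_induct)
  case base
  show ?case
    unfolding schur_def by (intro arg_cong[of _ _ det] eq_matI) (auto simp: pad_def)
next
  case (step n)
  show ?case
    unfolding step.IH
    by (rule det_last_row_unit[of n "\<lambda>i j. complete_sym N x (int (pad \<mu> i) - int i + int j)", symmetric])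
       (use step.hyps in \<open>auto simp: pad_def complete_sym_eq_hsym\<close>)
qed

text \<open>Subtracting \<open>i\<close> from the \<open>i\<close>-th part makes the weakly decreasing parts strictly decreasing; a part between 0
and \<open>M\<close> becomes an entry between \<open>1 - N\<close> and \<open>M\<close>.\<close>

lemma bij_betw_partitions_decreasing:
  "bij_betw (\<lambda>\<mu>. map (\<lambda>i. int (pad \<mu> i) - int i) [0..<N])
    {\<mu>. is_partition \<mu> \<and> length \<mu> \<le> N \<and> (\<forall>k\<in>set \<mu>. k \<le> M)}
    {ds. sorted_wrt (>) ds \<and> length ds = N \<and> set ds \<subseteq> {1 - int N..int M}}"
    (is "bij_betw ?f ?P ?D")
proof (rule bij_betw_imageI)
  have pos: "(i < length \<mu>) = (0 < pad \<mu> i)" if "is_partition \<mu>" for \<mu> i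
    using that by (auto simp: pad_def is_partition_def)
  have mono: "pad \<mu> j \<le> pad \<mu> i" if "is_partition \<mu>" "i \<le> j" for \<mu> i j
    using that by (cases "i = j") (auto simp: pad_def is_partition_def sorted_wrt_iff_nth_less)
  show "inj_on ?f ?P"
  proof (rule inj_onI)
    fix \<mu> \<nu> assume \<mu>: "\<mu> \<in> ?P" and \<nu>: "\<nu> \<in> ?P" and eq: "?f \<mu> = ?f \<nu>"
    have "pad \<mu> i = pad \<nu> i" for i
    proof (cases "i < N")
      case True
      then show ?thesis using arg_cong[OF eq, of "\<lambda>ds. ds ! i"] by simp
    next
      case False
      then show ?thesis using \<mu> \<nu> by (simp add: pad_def)
    qed
    then have len: "i < length \<mu> \<longleftrightarrow> i < length \<nu>" and pad: "pad \<mu> i = pad \<nu> i" for i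
      using pos[of \<mu> i] pos[of \<nu> i] \<mu> \<nu> by simp_all
    have "length \<mu> = length \<nu>"
      using len[of "length \<mu>"] len[of "length \<nu>"] by simp
    then show "\<mu> = \<nu>"
      using pad by (intro nth_equalityI) (auto simp: pad_def split: if_splits, metis)
  qed
  show "?f ` ?P = ?D"
  proof (intro equalityI subsetI)
    fix ds assume "ds \<in> ?f ` ?P"
    then obtain \<mu> where \<mu>: "\<mu> \<in> ?P" and ds: "ds = ?f \<mu>" by blast
    have "pad \<mu> i \<le> M" for i
      using \<mu> by (auto simp: pad_def)
    then have "int (pad \<mu> i) - int i \<le> int M" for i
      by (metis diff_le_eq add_increasing2 of_nat_0_le_iff of_nat_le_iff)
    moreover have "sorted_wrt (>) ds"
      unfolding ds sorted_wrt_iff_nth_less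
    proof (intro allI impI)
      fix i j assume ij: "i < j" "j < length (?f \<mu>)"
      have "pad \<mu> j \<le> pad \<mu> i" using mono[of \<mu> i j] \<mu> ij by simp
      then show "?f \<mu> ! j < ?f \<mu> ! i" using ij by simp
    qed
    ultimately show "ds \<in> ?D"
      unfolding ds by (auto simp: algebra_simps intro: add_increasing)
  next
    fix ds assume ds: "ds \<in> ?D"
    define g where "g i = ds ! i + int i" for i
    have g_Suc: "g (Suc i) \<le> g i" if "Suc i < N" for i
    proof -
      have "ds ! Suc i < ds ! i" using ds that by (auto simp: sorted_wrt_iff_nth_less)
      then show ?thesis by (simp add: g_def)
    qed
    have g_mono: "g j \<le> g i" if "i \<le> j" "j < N" for i j
      using that
    proof (induction j rule: dec_induct)
      case (step n)
      then show ?case using g_Suc[of n] by simp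
    qed simp
    have g_nonneg: "0 \<le> g i" if "i < N" for i
    proof -
      have "ds ! (N - 1) \<in> {1 - int N..int M}"
        using ds that by (auto simp: subset_iff)
      then have "0 \<le> g (N - 1)"
        using that by (auto simp: g_def of_nat_diff)
      also have "\<dots> \<le> g i" using that by (intro g_mono) auto
      finally show ?thesis .
    qed
    have g_le: "g i \<le> int M" if "i < N" for i
    proof -
      have "ds ! 0 \<in> {1 - int N..int M}"
        using ds that by (auto simp: subset_iff)
      then show ?thesis using g_mono[of 0 i] that by (simp add: g_def)
    qed
    \<comment> \<open>the number of nonzero parts: since \<open>g\<close> is decreasing, they form an initial segment\<close>
    define l where "l = (LEAST k. \<not> (k < N \<and> 0 < g k))"
    have l_no: "\<not> (l < N \<and> 0 < g l)"
      unfolding l_def by (rule LeastI[of _ N]) simp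
    have l: "l \<le> N"
      unfolding l_def by (rule Least_le) simp
    have pos_l: "i < l \<longleftrightarrow> i < N \<and> 0 < g i" for i
    proof
      show "i < N \<and> 0 < g i" if "i < l"
        using not_less_Least[of i] that unfolding l_def by blast
      show "i < l" if i: "i < N \<and> 0 < g i"
      proof (rule ccontr)
        assume "\<not> i < l"
        then show False using l_no g_mono[of l i] i by auto
      qed
    qed
    define \<mu> where "\<mu> = map (\<lambda>i. nat (g i)) [0..<l]"
    have "sorted_wrt (\<ge>) \<mu>"
      unfolding sorted_wrt_iff_nth_less
    proof (intro allI impI)
      fix i j assume ij: "i < j" "j < length \<mu>"
      then have "g j \<le> g i"
        using l by (intro g_mono) (auto simp: \<mu>_def)
      then show "\<mu> ! j \<le> \<mu> ! i"
        using ij by (simp add: \<mu>_def nat_mono)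
    qed
    then have "\<mu> \<in> ?P"
      using l pos_l g_le
      by (auto simp: \<mu>_def is_partition_def nat_le_iff)
    moreover have "?f \<mu> = ds"
    proof (rule nth_equalityI)
      show "length (?f \<mu>) = length ds" using ds by simp
      fix i assume i: "i < length (?f \<mu>)"
      then have "int (pad \<mu> i) = g i"
        using pos_l[of i] g_nonneg[of i] by (auto simp: \<mu>_def pad_def)
      then show "?f \<mu> ! i = ds ! i" using i by (simp add: g_def)
    qed
    ultimately show "ds \<in> ?f ` ?P" by blast
  qed
qed

text \<open>The Cauchy--Binet formula, with the row sets of the minors read as shifted partitions.\<close>

lemma schur_sum_eq_det:
  fixes x y :: "nat \<Rightarrow> 'r :: comm_ring_1"
  shows "(\<Sum>\<mu> | is_partition \<mu> \<and> length \<mu> \<le> N \<and> (\<forall>k\<in>set \<mu>. k \<le> M). schur N x \<mu> * schur N y \<mu>)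
    = det (mat N N (\<lambda>(i, j). \<Sum>s\<in>{1 - int N..int M}.
        complete_sym N x (s + int i) * complete_sym N y (s + int j)))"
proof -
  have "det (mat N N (\<lambda>(i, j). \<Sum>s\<in>{1 - int N..int M}.
        complete_sym N x (s + int i) * complete_sym N y (s + int j)))
      = (\<Sum>ds | sorted_wrt (>) ds \<and> length ds = N \<and> set ds \<subseteq> {1 - int N..int M}.
       det (mat N N (\<lambda>(i, j). complete_sym N x (ds ! i + int j)))
       * det (mat N N (\<lambda>(i, j). complete_sym N y (ds ! i + int j))))"
    by (subst cauchy_binet) auto
  also have "\<dots> = (\<Sum>\<mu> | is_partition \<mu> \<and> length \<mu> \<le> N \<and> (\<forall>k\<in>set \<mu>. k \<le> M).
       schur N x \<mu> * schur N y \<mu>)"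
  proof (subst sum.reindex_bij_betw[OF bij_betw_partitions_decreasing, symmetric], rule sum.cong[OF refl])
    fix \<mu> assume \<mu>: "\<mu> \<in> {\<mu>. is_partition \<mu> \<and> length \<mu> \<le> N \<and> (\<forall>k\<in>set \<mu>. k \<le> M)}"
    let ?ds = "map (\<lambda>i. int (pad \<mu> i) - int i) [0..<N]"
    have "schur N z \<mu> = det (mat N N (\<lambda>(i, j). complete_sym N z (?ds ! i + int j)))"
      for z :: "nat \<Rightarrow> 'r"
      using \<mu> by (subst schur_eq_padded_det[of _ N]) (auto intro!: arg_cong[of _ _ det] eq_matI)
    then show "det (mat N N (\<lambda>(i, j). complete_sym N x (?ds ! i + int j)))
       * det (mat N N (\<lambda>(i, j). complete_sym N y (?ds ! i + int j))) = schur N x \<mu> * schur N y \<mu>"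
      by simp
  qed
  finally show ?thesis ..
qed

section \<open>Row operations and complete symmetric polynomials\<close>

definition alt_sign :: "int \<Rightarrow> 'r :: comm_ring_1" where
  "alt_sign d = (if even d then 1 else - 1)"

lemma alt_sign_simps [simp]:
  "alt_sign 0 = 1" "alt_sign (d - 1) = - alt_sign d" "alt_sign (d + 1) = - alt_sign d"
  by (auto simp: alt_sign_def)

text \<open>The signs cancel in each term of the expansion, because \<open>i\<close> and \<open>p i\<close> run over the same indices.\<close>

lemma det_conjugate_signs:
  fixes A :: "nat \<Rightarrow> nat \<Rightarrow> 'r :: comm_ring_1"
  assumes "\<And>i. i < n \<Longrightarrow> e i * e i = 1"
  shows "det (mat n n (\<lambda>(i, j). e i * e j * A i j)) = det (mat n n (\<lambda>(i, j). A i j))"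
proof -
  have "(\<Prod>i=0..<n. e i * e (p i) * A i (p i)) = (\<Prod>i=0..<n. A i (p i))"
    if p: "p permutes {0..<n}" for p
  proof -
    have "(\<Prod>i=0..<n. e i * e (p i) * A i (p i))
        = (\<Prod>i=0..<n. e i) * (\<Prod>i=0..<n. e (p i)) * (\<Prod>i=0..<n. A i (p i))"
      by (simp add: prod.distrib)
    also have "(\<Prod>i=0..<n. e (p i)) = (\<Prod>i=0..<n. e i)"
      using prod.permute[OF p, of e] by (simp add: comp_def)
    also have "(\<Prod>i=0..<n. e i) * (\<Prod>i=0..<n. e i) = 1"
      using assms by (simp flip: prod.distrib)
    finally show ?thesis by simp
  qed
  then show ?thesis by (simp add: det_mat_eq)
qed

definition row_op :: "'r :: comm_ring_1 \<Rightarrow> int \<Rightarrow> int \<Rightarrow> (int \<Rightarrow> 'r) \<Rightarrow> int \<Rightarrow> 'r" where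
  "row_op z p q s = s(q := s q - z * s p)"

text \<open>Each row is corrected by a multiple of the row with the previous index, which has already been updated. The new rows therefore
solve a first-order recursion, and any solution \<open>T\<close> of the recursion describes the result.\<close>

lemma fold_row_op_ascending:
  assumes "T (M - int K) = s (M - int K)"
    and "\<And>j. M - int K < j \<Longrightarrow> j \<le> M \<Longrightarrow> T j = s j - z * T (j - 1)"
  shows "fold (\<lambda>k. row_op z (M - int k - 1) (M - int k)) (rev [0..<K]) s
    = (\<lambda>j. if M - int K < j \<and> j \<le> M then T j else s j)"
  using assms
proof (induction K arbitrary: s)
  case 0
  then show ?case by (auto simp: fun_eq_iff)
next
  case (Suc K)
  let ?s = "row_op z (M - int K - 1) (M - int K) s"
  have T: "T (M - int K) = s (M - int K) - z * s (M - int K - 1)"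
    using Suc.prems(1) Suc.prems(2)[of "M - int K"] by (simp add: algebra_simps)
  have "fold (\<lambda>k. row_op z (M - int k - 1) (M - int k)) (rev [0..<K]) ?s
      = (\<lambda>j. if M - int K < j \<and> j \<le> M then T j else ?s j)"
  proof (rule Suc.IH)
    show "T (M - int K) = ?s (M - int K)"
      by (simp add: T row_op_def)
    show "T j = ?s j - z * T (j - 1)" if "M - int K < j" "j \<le> M" for j
      using Suc.prems(2)[of j] that by (simp add: row_op_def)
  qed
  moreover have "?s j = (if j = M - int K then T j else s j)" for j
    by (simp add: T row_op_def)
  ultimately show ?case
    by (auto simp: fun_eq_iff)
qed

lemma fold_row_op_descending:
  assumes "T M = s M"
    and "\<And>j. M - int K \<le> j \<Longrightarrow> j < M \<Longrightarrow> T j = s j - z * T (j + 1)"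
  shows "fold (\<lambda>k. row_op z (M - int k) (M - int k - 1)) [0..<K] s
    = (\<lambda>j. if M - int K \<le> j \<and> j < M then T j else s j)"
  using assms(2)
proof (induction K)
  case 0
  then show ?case by (auto simp: fun_eq_iff)
next
  case (Suc K)
  have IH: "fold (\<lambda>k. row_op z (M - int k) (M - int k - 1)) [0..<K] s
      = (\<lambda>j. if M - int K \<le> j \<and> j < M then T j else s j)"
    by (rule Suc.IH) (use Suc.prems in auto)
  have T: "T (M - int K - 1) = s (M - int K - 1) - z * T (M - int K)"
    using Suc.prems[of "M - int K - 1"] by simp
  have "fold (\<lambda>k. row_op z (M - int k) (M - int k - 1)) [0..<Suc K] s
      = row_op z (M - int K) (M - int K - 1) (\<lambda>j. if M - int K \<le> j \<and> j < M then T j else s j)"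
    by (simp add: IH)
  also have "\<dots> = (\<lambda>j. if M - int (Suc K) \<le> j \<and> j < M then T j else s j)"
    using assms(1) T by (auto simp: row_op_def fun_eq_iff)
  finally show ?case .
qed

text \<open>The recursion solved by the new rows is the one for complete symmetric polynomials. So each
\<open>C\<^sup>*\<close> adds one variable.\<close>

lemma row_ops_ascending_hsym:
  fixes x :: "nat \<Rightarrow> 'r :: comm_ring_1"
  assumes V: "finite V" "v \<notin> V" and k: "M - int K \<le> k"
  shows "fold (\<lambda>i. row_op (x v) (M - int i - 1) (M - int i)) (rev [0..<K])
      (\<lambda>j. if j \<le> M then alt_sign (j - k) * hsym V x (j - k) else 0)
    = (\<lambda>j. if j \<le> M then alt_sign (j - k) * hsym (insert v V) x (j - k) else 0)"
    (is "fold _ _ (?s V) = ?s (insert v V)")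
proof -
  have base: "?s (insert v V) j = ?s V j" if "j \<le> M - int K" for j
    using that k by (cases "j = k") auto
  have step: "?s (insert v V) j = ?s V j - x v * ?s (insert v V) (j - 1)" if "j \<le> M" for j
  proof -
    define d where "d = j - k"
    then have "j = k + d" by simp
    then show ?thesis
      using that hsym_insert[OF V, of x d, symmetric]
      by (simp add: right_diff_distrib mult.left_commute)
  qed
  have "fold (\<lambda>i. row_op (x v) (M - int i - 1) (M - int i)) (rev [0..<K]) (?s V)
      = (\<lambda>j. if M - int K < j \<and> j \<le> M then ?s (insert v V) j else ?s V j)"
  proof (rule fold_row_op_ascending)
    show "?s (insert v V) (M - int K) = ?s V (M - int K)"
      by (rule base) simp
    show "?s (insert v V) j = ?s V j - x v * ?s (insert v V) (j - 1)" if "j \<le> M" for j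
      using that by (rule step)
  qed
  also have "\<dots> = ?s (insert v V)"
  proof
    fix j
    show "(if M - int K < j \<and> j \<le> M then ?s (insert v V) j else ?s V j) = ?s (insert v V) j"
      using base[of j] by (cases "M - int K < j") auto
  qed
  finally show ?thesis .
qed

text \<open>The counterpart for \<open>B\<^sup>*\<close>, where the rows are processed in the order of decreasing index. The column \<open>c\<close> is
arbitrary because these operations are applied to the result of those for \<open>C\<^sup>*\<close>.\<close>

lemma row_ops_descending_hsym:
  fixes y :: "nat \<Rightarrow> 'r :: comm_ring_1" and c :: "int \<Rightarrow> 'r" and M :: int and K :: nat
  assumes V: "finite V" "v \<notin> V"
  defines "s \<equiv> \<lambda>V j. if M - int K \<le> j \<and> j \<le> M
      then \<Sum>i\<in>{M - int K..M}. alt_sign (i - j) * hsym V y (i - j) * c i else c j"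
  shows "fold (\<lambda>k. row_op (y v) (M - int k) (M - int k - 1)) [0..<K] (s V) = s (insert v V)"
proof -
  have top: "(\<Sum>i\<in>{M - int K..M}. alt_sign (i - M) * hsym V y (i - M) * c i) = c M" for V
  proof -
    have "(\<Sum>i\<in>{M - int K..M}. alt_sign (i - M) * hsym V y (i - M) * c i)
        = (\<Sum>i\<in>{M}. alt_sign (i - M) * hsym V y (i - M) * c i)"
      by (rule sum.mono_neutral_right) auto
    then show ?thesis by simp
  qed
  have step: "s (insert v V) j = s V j - y v * s (insert v V) (j + 1)"
    if j: "M - int K \<le> j" "j < M" for j
  proof -
    have "alt_sign (i - j) * hsym (insert v V) y (i - j) * c i
        + y v * (alt_sign (i - (j + 1)) * hsym (insert v V) y (i - (j + 1)) * c i)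
        = alt_sign (i - j) * hsym V y (i - j) * c i" for i
    proof -
      define d where "d = i - j"
      then have "i = j + d" by simp
      then show ?thesis
        using hsym_insert[OF V, of y d, symmetric]
        by (simp add: left_diff_distrib right_diff_distrib mult_ac)
    qed
    then have "(\<Sum>i\<in>{M - int K..M}. alt_sign (i - j) * hsym (insert v V) y (i - j) * c i)
        + y v * (\<Sum>i\<in>{M - int K..M}. alt_sign (i - (j + 1)) * hsym (insert v V) y (i - (j + 1)) * c i)
        = (\<Sum>i\<in>{M - int K..M}. alt_sign (i - j) * hsym V y (i - j) * c i)"
      by (simp only: sum_distrib_left flip: sum.distrib)
    then show ?thesis
      using j by (simp add: s_def eq_diff_eq)
  qed
  have "fold (\<lambda>k. row_op (y v) (M - int k) (M - int k - 1)) [0..<K] (s V)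
      = (\<lambda>j. if M - int K \<le> j \<and> j < M then s (insert v V) j else s V j)"
  proof (rule fold_row_op_descending)
    show "s (insert v V) M = s V M"
      by (simp only: s_def top)
  qed (rule step)
  also have "\<dots> = s (insert v V)"
  proof
    fix j
    show "(if M - int K \<le> j \<and> j < M then s (insert v V) j else s V j) = s (insert v V) j"
      by (cases "j = M") (auto simp: s_def top)
  qed
  finally show ?thesis .
qed

section \<open>The companion matrix\<close>

text \<open>\<open>signed_esym y n l\<close> is the coefficient of \<open>t ^ l\<close> in the product of \<open>1 - y j * t\<close> for \<open>j = 1, \<dots>, n\<close>.\<close>

primrec signed_esym :: "(nat \<Rightarrow> 'r :: comm_ring_1) \<Rightarrow> nat \<Rightarrow> nat \<Rightarrow> 'r" where
  "signed_esym y 0 l = (if l = 0 then 1 else 0)"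
| "signed_esym y (Suc n) l = signed_esym y n l - y (Suc n) * (if l = 0 then 0 else signed_esym y n (l - 1))"

lemma signed_esym_0 [simp]: "signed_esym y n 0 = 1"
  by (induction n) auto

lemma signed_esym_beyond: "l > n \<Longrightarrow> signed_esym y n l = 0"
  by (induction n arbitrary: l) auto

lemma sum_signed_esym_Suc:
  fixes y :: "nat \<Rightarrow> 'r :: comm_ring_1"
  shows "(\<Sum>l\<le>Suc n. signed_esym y (Suc n) l * f l)
    = (\<Sum>l\<le>n. signed_esym y n l * (f l - y (Suc n) * f (Suc l)))"
proof -
  have "(\<Sum>l\<le>Suc n. signed_esym y (Suc n) l * f l)
      = (\<Sum>l\<le>Suc n. signed_esym y n l * f l)
        - (\<Sum>l\<le>Suc n. y (Suc n) * (if l = 0 then 0 else signed_esym y n (l - 1)) * f l)"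
    by (simp add: algebra_simps sum_subtractf)
  also have "(\<Sum>l\<le>Suc n. signed_esym y n l * f l) = (\<Sum>l\<le>n. signed_esym y n l * f l)"
    by (simp add: signed_esym_beyond)
  also have "(\<Sum>l\<le>Suc n. y (Suc n) * (if l = 0 then 0 else signed_esym y n (l - 1)) * f l)
      = (\<Sum>l\<le>n. y (Suc n) * signed_esym y n l * f (Suc l))"
    by (subst sum.atMost_Suc_shift) simp
  finally show ?thesis
    by (simp add: algebra_simps sum_subtractf)
qed

text \<open>The product of the generating functions of both families is 1. In other words, the complete symmetric
polynomials satisfy the linear recursion whose companion matrix occurs below.\<close>

lemma sum_signed_esym_hsym:
  fixes y :: "nat \<Rightarrow> 'r :: comm_ring_1"
  shows "(\<Sum>l\<le>n. signed_esym y n l * hsym {1..n} y (m - int l)) = (if m = 0 then 1 else 0)"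
proof (induction n)
  case 0
  then show ?case by (simp add: hsym_empty)
next
  case (Suc n)
  have "{1..Suc n} = insert (Suc n) {1..n}" by auto
  then have "hsym {1..Suc n} y (m - int l) - y (Suc n) * hsym {1..Suc n} y (m - int (Suc l))
      = hsym {1..n} y (m - int l)" for l
    using hsym_insert[of "{1..n}" "Suc n" y "m - int l"] by (simp add: algebra_simps)
  then show ?case
    by (simp only: sum_signed_esym_Suc Suc.IH)
qed

lemma sum_signed_esym_power:
  fixes y :: "nat \<Rightarrow> 'r :: comm_ring_1"
  shows "(\<Sum>l\<le>n. signed_esym y n l * t ^ l) = (\<Prod>j=1..n. 1 - t * y j)"
proof (induction n)
  case (Suc n)
  have "(\<Sum>l\<le>n. signed_esym y n l * (t ^ l - y (Suc n) * t ^ Suc l))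
      = (\<Sum>l\<le>n. signed_esym y n l * t ^ l) * (1 - t * y (Suc n))"
    by (simp add: sum_distrib_left sum_subtractf algebra_simps)
  then show ?case
    by (simp only: sum_signed_esym_Suc Suc.IH) (simp add: mult.commute)
qed simp

text \<open>Right multiplication by \<open>1 - t K\<close>, where \<open>K\<close> sends each unit vector to the previous one and the first unit
vector to a combination with coefficients \<open>- c 1, \<dots>, - c n\<close>.\<close>

lemma sum_companion_column:
  fixes u :: "nat \<Rightarrow> 'r :: comm_ring_1"
  assumes j: "j < n"
  shows "(\<Sum>l<n. u l * ((if l = j then 1 else 0) - (if Suc l = j then t else 0)
      + (if j = 0 then t * c (Suc l) else 0)))
    = u j - (if j = 0 then 0 else u (j - 1) * t)
      + (if j = 0 then t * (\<Sum>l<n. u l * c (Suc l)) else 0)"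
proof -
  have "(\<Sum>l<n. u l * ((if l = j then 1 else 0) - (if Suc l = j then t else 0)
      + (if j = 0 then t * c (Suc l) else 0)))
    = (\<Sum>l<n. if l = j then u l else 0) - (\<Sum>l<n. if Suc l = j then u l * t else 0)
      + (\<Sum>l<n. if j = 0 then t * (u l * c (Suc l)) else 0)"
    unfolding sum.distrib[symmetric] sum_subtractf[symmetric]
    by (intro sum.cong refl) (auto simp: algebra_simps)
  also have "(\<Sum>l<n. if l = j then u l else 0) = u j"
    using j by simp
  also have "(\<Sum>l<n. if Suc l = j then u l * t else 0) = (if j = 0 then 0 else u (j - 1) * t)"
  proof (cases j)
    case (Suc j')
    then show ?thesis using j by simp
  qed simp
  finally show ?thesis by (simp add: sum_distrib_left)
qed

text \<open>Left multiplication by the unitriangular matrix of the powers of \<open>t\<close> makes the matrix lower triangular and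
collects the whole sum in its first diagonal entry.\<close>

lemma det_one_minus_companion:
  fixes t :: "'r :: comm_ring_1"
  assumes n: "n > 0"
  shows "det (mat n n (\<lambda>(l, j). (if l = j then 1 else 0) - (if Suc l = j then t else 0)
      + (if j = 0 then t * c (Suc l) else 0))) = 1 + (\<Sum>l<n. t ^ Suc l * c (Suc l))"
    (is "det ?Q = _")
proof -
  let ?U = "mat n n (\<lambda>(i, l). if i \<le> l then t ^ (l - i) else 0)"
  have Q: "?Q \<in> carrier_mat n n" and U: "?U \<in> carrier_mat n n" by auto
  have detU: "det ?U = 1"
  proof -
    have "det ?U = prod_list (diag_mat ?U)"
      by (rule det_upper_triangular[OF _ U]) (auto simp: upper_triangular_def)
    also have "diag_mat ?U = map (\<lambda>_. 1) [0..<n]"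
      by (auto simp: diag_mat_def)
    finally show ?thesis by (simp add: map_replicate_const)
  qed
  have entry: "(?U * ?Q) $$ (i, j) = (if i = j then 1 else 0)
      + (if j = 0 then t * (\<Sum>l<n. (if i \<le> l then t ^ (l - i) else 0) * c (Suc l)) else 0)"
    if i: "i < n" and j: "j < n" for i j
  proof -
    define u where "u l = (if i \<le> l then t ^ (l - i) else 0)" for l
    have "(?U * ?Q) $$ (i, j) = (\<Sum>l<n. u l * ((if l = j then 1 else 0) - (if Suc l = j then t else 0)
      + (if j = 0 then t * c (Suc l) else 0)))"
      using i j by (simp add: scalar_prod_def lessThan_atLeast0 u_def)
    also have "\<dots> = u j - (if j = 0 then 0 else u (j - 1) * t)
        + (if j = 0 then t * (\<Sum>l<n. u l * c (Suc l)) else 0)"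
      using j by (rule sum_companion_column)
    also have "u j - (if j = 0 then 0 else u (j - 1) * t) = (if i = j then 1 else 0)"
    proof (cases j)
      case (Suc j')
      then show ?thesis by (auto simp: u_def Suc_diff_le le_Suc_eq)
    qed (auto simp: u_def)
    finally show ?thesis by (simp add: u_def)
  qed
  have "det ?Q = det (?U * ?Q)"
    by (simp add: det_mult[OF U Q] detU)
  also have "\<dots> = prod_list (diag_mat (?U * ?Q))"
  proof (rule det_lower_triangular[of n])
    show "(?U * ?Q) $$ (i, j) = 0" if "i < j" "j < n" for i j
      using that by (subst entry) auto
    show "?U * ?Q \<in> carrier_mat n n"
      using U Q by (rule mult_carrier_mat)
  qed
  also have "diag_mat (?U * ?Q) = map (\<lambda>i. if i = 0 then 1 + (\<Sum>l<n. t ^ Suc l * c (Suc l)) else 1) [0..<n]"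
  proof -
    have "diag_mat (?U * ?Q) = map (\<lambda>i. (?U * ?Q) $$ (i, i)) [0..<n]"
      by (simp only: diag_mat_def index_mult_mat(2) dim_row_mat)
    also have "\<dots> = map (\<lambda>i. if i = 0 then 1 + (\<Sum>l<n. t ^ Suc l * c (Suc l)) else 1) [0..<n]"
    proof (rule map_cong[OF refl])
      fix i assume "i \<in> set [0..<n]"
      then have "i < n" by simp
      then show "(?U * ?Q) $$ (i, i) = (if i = 0 then 1 + (\<Sum>l<n. t ^ Suc l * c (Suc l)) else 1)"
        by (simp only: entry) (simp add: sum_distrib_left mult.assoc)
    qed
    finally show ?thesis .
  qed
  also have "prod_list \<dots> = 1 + (\<Sum>l<n. t ^ Suc l * c (Suc l))"
  proof -
    have "[0..<n] = 0 # [1..<n]" using n by (simp add: upt_conv_Cons)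
    moreover have "map (\<lambda>i. if i = 0 then a else 1) [1..<n] = map (\<lambda>_. 1) [1..<n]" for a :: 'r
      by (intro map_cong) auto
    ultimately show ?thesis by (simp only: list.map if_True prod_list.Cons) (simp add: map_replicate_const)
  qed
  finally show ?thesis .
qed

section \<open>Coefficientwise convergence and the Cauchy identity\<close>

lemma mps_coeff_simps [simp]:
  "mps_coeff 0 m = 0"
  "mps_coeff (f + g) m = mps_coeff f m + mps_coeff g m"
  "mps_coeff (f - g) m = mps_coeff f m - mps_coeff g m"
  "mps_coeff (- f) m = - mps_coeff f m"
  by (simp_all add: zero_mps_def plus_mps_def minus_mps_def uminus_mps_def)

lemma mps_coeff_mult:
  "mps_coeff (f * g) m = (\<Sum>(p, q)\<in>splits m. mps_coeff f p * mps_coeff g q)"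
  by (simp add: times_mps_def)

lemma mps_coeff_sum [simp]: "mps_coeff (\<Sum>i\<in>A. f i) m = (\<Sum>i\<in>A. mps_coeff (f i) m)"
  by (induction A rule: infinite_finite_induct) auto

lemma eventually_nhds_mps_coeff:
  fixes a :: "('i, 'a :: comm_ring_1) mps"
  shows "\<forall>\<^sub>F f in nhds a. mps_coeff f m = mps_coeff a m"
  using open_mps_cylinder[of m "mps_coeff a m"] by (auto simp: eventually_nhds)

text \<open>Addition and multiplication are continuous because a coefficient of the result depends on finitely many
coefficients of the arguments. The class instances make the limit theorems for finite sums and products
available.\<close>

instance mps :: (type, comm_ring_1) topological_comm_monoid_add
proof
  fix a b :: "('a, 'b) mps"
  show "((\<lambda>x. fst x + snd x) \<longlongrightarrow> a + b) (nhds a \<times>\<^sub>F nhds b)"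
    unfolding tendsto_mps_iff
  proof
    fix m
    show "\<forall>\<^sub>F x in nhds a \<times>\<^sub>F nhds b. mps_coeff (fst x + snd x) m = mps_coeff (a + b) m"
      using eventually_prodI[OF eventually_nhds_mps_coeff[of m a] eventually_nhds_mps_coeff[of m b]]
      by (rule eventually_mono) auto
  qed
qed

instance mps :: (type, comm_ring_1) topological_semigroup_mult
proof
  fix a b :: "('a, 'b) mps"
  show "((\<lambda>x. fst x * snd x) \<longlongrightarrow> a * b) (nhds a \<times>\<^sub>F nhds b)"
    unfolding tendsto_mps_iff
  proof
    fix m
    have ev: "\<forall>\<^sub>F f in nhds c. \<forall>q\<in>S. mps_coeff f q = mps_coeff c q" if "finite S"
      for c :: "('a, 'b) mps" and S
      using that by (rule eventually_ball_finite) (simp add: eventually_nhds_mps_coeff)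
    have "\<forall>\<^sub>F x in nhds a \<times>\<^sub>F nhds b. (\<forall>q\<in>fst ` splits m. mps_coeff (fst x) q = mps_coeff a q)
        \<and> (\<forall>q\<in>snd ` splits m. mps_coeff (snd x) q = mps_coeff b q)"
      by (rule eventually_prodI[OF ev ev]) auto
    then show "\<forall>\<^sub>F x in nhds a \<times>\<^sub>F nhds b. mps_coeff (fst x * snd x) m = mps_coeff (a * b) m"
    proof (rule eventually_mono)
      fix x :: "('a, 'b) mps \<times> ('a, 'b) mps"
      assume x: "(\<forall>q\<in>fst ` splits m. mps_coeff (fst x) q = mps_coeff a q)
        \<and> (\<forall>q\<in>snd ` splits m. mps_coeff (snd x) q = mps_coeff b q)"
      show "mps_coeff (fst x * snd x) m = mps_coeff (a * b) m"
        unfolding mps_coeff_mult by (rule sum.cong) (use x in \<open>force+\<close>)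
    qed
  qed
qed

instance mps :: (type, comm_ring_1) topological_comm_monoid_mult ..

lemma tendsto_det_mps:
  fixes f :: "_ \<Rightarrow> nat \<Rightarrow> nat \<Rightarrow> ('i, 'a :: comm_ring_1) mps"
  assumes "\<And>i j. i < n \<Longrightarrow> j < n \<Longrightarrow> ((\<lambda>k. f k i j) \<longlongrightarrow> l i j) F"
  shows "((\<lambda>k. det (mat n n (\<lambda>(i, j). f k i j))) \<longlongrightarrow> det (mat n n (\<lambda>(i, j). l i j))) F"
  unfolding det_mat_eq
proof (intro tendsto_sum tendsto_mult tendsto_const)
  fix p :: "nat \<Rightarrow> nat" assume "p \<in> {p. p permutes {0..<n}}"
  then have p: "p permutes {0..<n}" by simp
  have "((\<lambda>k. \<Prod>i=0..<n. f k i (p i)) \<longlongrightarrow> (\<Prod>i=0..<n. l i (p i))) F"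
    by (intro tendsto_prod' assms) (use permutes_in_image[OF p] in auto)
  then show "((\<lambda>k. \<Prod>i=0..<n. case (i, p i) of (i, j) \<Rightarrow> f k i j)
      \<longlongrightarrow> (\<Prod>i=0..<n. case (i, p i) of (i, j) \<Rightarrow> l i j)) F"
    by simp
qed

definition mon_deg :: "('i \<Rightarrow>\<^sub>0 nat) \<Rightarrow> nat" where
  "mon_deg m = (\<Sum>i\<in>Poly_Mapping.keys m. Poly_Mapping.lookup m i)"

lemma mon_deg_add [simp]: "mon_deg (p + q) = mon_deg p + mon_deg q"
  unfolding mon_deg_def by (rule setsum_keys_plus_distrib) auto

lemma mon_deg_single [simp]: "mon_deg (Poly_Mapping.single i n) = n"
  by (cases "n = 0") (simp_all add: mon_deg_def)

text \<open>The ideal of the series all of whose terms have total degree at least \<open>d\<close>.\<close>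

definition order_ge :: "nat \<Rightarrow> ('i, 'a :: comm_ring_1) mps \<Rightarrow> bool" where
  "order_ge d f \<longleftrightarrow> (\<forall>m. mon_deg m < d \<longrightarrow> mps_coeff f m = 0)"

lemma order_ge_trivial [simp]: "order_ge 0 f" "order_ge d 0"
  by (simp_all add: order_ge_def)

lemma order_ge_mult:
  fixes f g :: "('i, 'a :: comm_ring_1) mps"
  assumes "order_ge a f" "order_ge b g"
  shows "order_ge (a + b) (f * g)"
  unfolding order_ge_def mps_coeff_mult
proof (intro allI impI sum.neutral ballI)
  fix m :: "'i \<Rightarrow>\<^sub>0 nat" and z assume "mon_deg m < a + b" "z \<in> splits m"
  then obtain p q where "z = (p, q)" "mon_deg p + mon_deg q < a + b"
    by (auto simp: splits_def)
  then show "(case z of (p, q) \<Rightarrow> mps_coeff f p * mps_coeff g q) = 0"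
    using assms by (cases "mon_deg p < a") (auto simp: order_ge_def)
qed

lemma order_ge_mult_left: "order_ge d f \<Longrightarrow> order_ge d (f * g)"
  using order_ge_mult[of d f 0 g] by simp

lemma order_ge_mult_right: "order_ge d g \<Longrightarrow> order_ge d (f * g)"
  using order_ge_mult[of 0 f d g] by simp

lemma order_ge_sum: "(\<And>i. i \<in> A \<Longrightarrow> order_ge d (f i)) \<Longrightarrow> order_ge d (\<Sum>i\<in>A. f i)"
  by (simp add: order_ge_def)

lemma order_ge_prod:
  assumes "finite A" "i \<in> A" "order_ge d (f i)"
  shows "order_ge d (\<Prod>i\<in>A. f i)"
  using assms by (simp add: prod.remove[of A i] order_ge_mult_left)

lemma order_ge_var: "order_ge 1 (mps_var z)"
  by (auto simp: order_ge_def mps_var_def)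

lemma order_ge_hsym:
  assumes "\<And>i. order_ge 1 (x i)"
  shows "order_ge (nat k) (hsym V x k)"
proof (cases "k < 0")
  case False
  have "order_ge (size A) (\<Prod>i\<in>#A. x i)" for A :: "nat multiset"
    by (induction A) (use order_ge_mult[OF assms] in auto)
  then show ?thesis
    using False unfolding hsym_def by (auto intro!: order_ge_sum) metis
qed simp

lemma tendsto_zero_order_ge:
  assumes "\<And>M. order_ge M (f M)"
  shows "f \<longlonglongrightarrow> 0"
  unfolding tendsto_mps_iff
proof
  fix m
  show "\<forall>\<^sub>F M in sequentially. mps_coeff (f M) m = mps_coeff 0 m"
    by (rule eventually_mono[OF eventually_gt_at_top[of "mon_deg m"]])
       (use assms in \<open>simp add: order_ge_def\<close>)
qed

text \<open>Each coefficient of the partial sums is constant from the degree of its monomial on.\<close>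

lemma convergent_sum_order_ge:
  fixes f :: "int \<Rightarrow> ('i, 'a :: comm_ring_1) mps"
  assumes "\<And>s. order_ge (nat s) (f s)"
  obtains l where "(\<lambda>M. \<Sum>s\<in>{a..int M}. f s) \<longlonglongrightarrow> l"
proof
  let ?l = "Abs_mps (\<lambda>m. \<Sum>s\<in>{a..int (mon_deg m)}. mps_coeff (f s) m)"
  show "(\<lambda>M. \<Sum>s\<in>{a..int M}. f s) \<longlonglongrightarrow> ?l"
    unfolding tendsto_mps_iff
  proof
    fix m
    have stable: "(\<Sum>s\<in>{a..int M}. mps_coeff (f s) m) = (\<Sum>s\<in>{a..int (mon_deg m)}. mps_coeff (f s) m)"
      if "M \<ge> mon_deg m" for M
    proof (rule sum.mono_neutral_right)
      show "\<forall>s\<in>{a..int M} - {a..int (mon_deg m)}. mps_coeff (f s) m = 0"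
      proof
        fix s assume "s \<in> {a..int M} - {a..int (mon_deg m)}"
        then have "mon_deg m < nat s" by auto
        then show "mps_coeff (f s) m = 0" using assms[of s] by (simp add: order_ge_def)
      qed
    qed (use that in auto)
    show "\<forall>\<^sub>F M in sequentially. mps_coeff (\<Sum>s\<in>{a..int M}. f s) m = mps_coeff ?l m"
    proof (rule eventually_mono[OF eventually_ge_at_top[of "mon_deg m"]])
      fix M assume "mon_deg m \<le> M"
      from stable[OF this]
      show "mps_coeff (\<Sum>s\<in>{a..int M}. f s) m = mps_coeff ?l m" by simp
    qed
  qed
qed

text \<open>The difference \<open>f M - p\<close> equals \<open>f M * p * (l - g M)\<close>. Nothing is known about the convergence of \<open>f\<close>, but a
multiple of a null sequence is a null sequence, since each coefficient of the product involves only
finitely many coefficients of the second factor, which are eventually 0.\<close>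

lemma tendsto_inverse_of_tendsto:
  fixes f g :: "nat \<Rightarrow> ('i, 'a :: comm_ring_1) mps"
  assumes inv: "\<And>M. f M * g M = 1" and lim: "g \<longlonglongrightarrow> l" and l: "l * p = 1"
  shows "f \<longlonglongrightarrow> p"
proof -
  have diff: "f M = p + f M * (p * (l - g M))" for M
  proof -
    have "f M * (p * (l - g M)) = f M * (l * p) - (f M * g M) * p"
      by (simp add: algebra_simps)
    then show ?thesis by (simp add: inv l)
  qed
  have "(\<lambda>M. p * (l - g M)) \<longlonglongrightarrow> p * (l - l)"
    unfolding diff_conv_add_uminus
    by (intro tendsto_mult tendsto_add tendsto_const)
       (use lim in \<open>auto simp: tendsto_mps_iff elim: eventually_mono\<close>)
  then have null: "\<forall>\<^sub>F M in sequentially. mps_coeff (p * (l - g M)) m = 0" for m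
    by (simp add: tendsto_mps_iff)
  have "\<forall>\<^sub>F M in sequentially. mps_coeff (f M) m = mps_coeff p m" for m
  proof -
    have "\<forall>\<^sub>F M in sequentially. \<forall>q\<in>snd ` splits m. mps_coeff (p * (l - g M)) q = 0"
      by (rule eventually_ball_finite) (simp_all add: null)
    then show ?thesis
    proof (rule eventually_mono)
      fix M assume "\<forall>q\<in>snd ` splits m. mps_coeff (p * (l - g M)) q = 0"
      then have "mps_coeff (f M * (p * (l - g M))) m = 0"
        unfolding mps_coeff_mult[of "f M"] by (intro sum.neutral) force
      then show "mps_coeff (f M) m = mps_coeff p m"
        by (subst diff) simp
    qed
  qed
  then show ?thesis by (simp add: tendsto_mps_iff)
qed

text \<open>After a shift of the summation index the recursion for complete symmetric polynomials in \<open>y\<close> annihilates every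
term with \<open>s \<le> M\<close>. What remains comes from the truncation at \<open>M\<close> and has large degree.\<close>

lemma hsym_convolution_order_ge:
  fixes x y :: "nat \<Rightarrow> ('i, 'a :: comm_ring_1) mps"
  assumes x: "\<And>i. order_ge 1 (x i)"
  shows "order_ge M (\<Sum>l\<le>n. signed_esym y n l *
    (\<Sum>s\<in>{1 - int n..int M}. hsym {1..n} y (s + int i) * hsym V x (s + int l - 1)))"
proof -
  define f where "f l s = hsym {1..n} y (s + int i - int l) * hsym V x (s - 1)" for l :: nat and s
  have tail: "order_ge M (f l s)" if "s > int M" for l s
  proof -
    have "order_ge (nat (s - 1)) (f l s)"
      unfolding f_def by (intro order_ge_mult_right order_ge_hsym x)
    then show ?thesis using that by (auto simp: order_ge_def)
  qed
  have shift: "(\<Sum>s\<in>{1 - int n..int M}. hsym {1..n} y (s + int i) * hsym V x (s + int l - 1))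
      = (\<Sum>s\<in>{1..int M}. f l s) + (\<Sum>s\<in>{int M<..int M + int l}. f l s)" if "l \<le> n" for l
  proof -
    have "(\<Sum>s\<in>{1 - int n..int M}. hsym {1..n} y (s + int i) * hsym V x (s + int l - 1))
        = (\<Sum>s\<in>{1 - int n + int l..int M + int l}. f l s)"
      by (rule sum.reindex_bij_witness[of _ "\<lambda>s. s - int l" "\<lambda>s. s + int l"])
         (auto simp: f_def algebra_simps)
    also have "\<dots> = (\<Sum>s\<in>{1..int M + int l}. f l s)"
      by (rule sum.mono_neutral_right) (use that in \<open>auto simp: f_def\<close>)
    also have "{1..int M + int l} = {1..int M} \<union> {int M<..int M + int l}"
      by auto
    finally show ?thesis
      by (subst (asm) sum.union_disjoint) auto
  qed
  have "(\<Sum>l\<le>n. signed_esym y n l * (\<Sum>s\<in>{1..int M}. f l s))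
      = (\<Sum>s\<in>{1..int M}. \<Sum>l\<le>n. signed_esym y n l * f l s)"
    by (simp add: sum_distrib_left sum.swap[of _ _ "{..n}"])
  also have "\<dots> = (\<Sum>s\<in>{1..int M}. (\<Sum>l\<le>n. signed_esym y n l * hsym {1..n} y (s + int i - int l))
      * hsym V x (s - 1))"
    by (simp add: f_def sum_distrib_right mult.assoc)
  also have "\<dots> = 0"
    by (rule sum.neutral, rule ballI, subst sum_signed_esym_hsym) auto
  finally have main: "(\<Sum>l\<le>n. signed_esym y n l * (\<Sum>s\<in>{1..int M}. f l s)) = 0" .
  have "(\<Sum>l\<le>n. signed_esym y n l *
      (\<Sum>s\<in>{1 - int n..int M}. hsym {1..n} y (s + int i) * hsym V x (s + int l - 1)))
    = (\<Sum>l\<le>n. signed_esym y n l *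
        ((\<Sum>s\<in>{1..int M}. f l s) + (\<Sum>s\<in>{int M<..int M + int l}. f l s)))"
    by (rule sum.cong) (simp_all only: shift atMost_iff)
  also have "\<dots> = (\<Sum>l\<le>n. signed_esym y n l * (\<Sum>s\<in>{int M<..int M + int l}. f l s))"
    using main by (simp add: distrib_left sum.distrib)
  also have "order_ge M \<dots>"
    by (intro order_ge_sum order_ge_mult_right tail) auto
  finally show ?thesis .
qed

text \<open>Let \<open>L V i k\<close> be the limit of the entries, with \<open>V\<close> the set of variables \<open>x\<close> in use. Removing a variable
\<open>v\<close> from \<open>V\<close> subtracts \<open>x v\<close> times the neighbouring column from each column. The column with index \<open>- 1\<close>
that this requires lies outside the matrix, but by \<open>hsym_convolution_order_ge\<close> it is a combination of the
columns inside. Hence removing \<open>v\<close> is right multiplication by \<open>1 - x v * K\<close> with a companion matrix \<open>K\<close>.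
Without variables \<open>x\<close> the matrix is unitriangular.\<close>

theorem cauchy_identity_limit:
  fixes x y :: "nat \<Rightarrow> ('i, 'a :: comm_ring_1) mps"
  assumes x: "\<And>i. order_ge 1 (x i)" and y: "\<And>i. order_ge 1 (y i)" and n: "n > 0"
  obtains d where
    "(\<lambda>M. det (mat n n (\<lambda>(i, j). \<Sum>s\<in>{1 - int n..int M}.
        hsym {1..n} y (s + int i) * hsym {1..n} x (s + int j)))) \<longlonglongrightarrow> d"
    "d * (\<Prod>i=1..n. \<Prod>j=1..n. 1 - x i * y j) = 1"
proof -
  define T where "T V i k M = (\<Sum>s\<in>{1 - int n..int M}. hsym {1..n} y (s + int i) * hsym V x (s + k))"
    for V :: "nat set" and i :: nat and k :: int and M :: nat
  have "\<exists>l. T V i k \<longlonglongrightarrow> l" for V i k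
  proof -
    have "order_ge (nat s) (hsym {1..n} y (s + int i) * hsym V x (s + k))" for s
    proof -
      have "order_ge (nat (s + int i)) (hsym {1..n} y (s + int i) * hsym V x (s + k))"
        by (intro order_ge_mult_left order_ge_hsym y)
      then show ?thesis by (auto simp: order_ge_def)
    qed
    then show ?thesis
      unfolding T_def[abs_def] by (rule convergent_sum_order_ge) blast
  qed
  then obtain L where L: "\<And>V i k. T V i k \<longlonglongrightarrow> L V i k" by metis
  let ?A = "\<lambda>V. mat n n (\<lambda>(i, j). L V i (int j))"
  have remove: "L V i k = L (insert v V) i k - x v * L (insert v V) i (k - 1)"
    if V: "finite V" "v \<notin> V" for V v i k
  proof (rule LIMSEQ_unique[OF L])
    have "T V i k = (\<lambda>M. T (insert v V) i k M + (- x v) * T (insert v V) i (k - 1) M)"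
      by (simp add: fun_eq_iff T_def hsym_insert[OF V, symmetric] algebra_simps sum_subtractf sum_negf sum_distrib_left)
    moreover have "(\<lambda>M. T (insert v V) i k M + (- x v) * T (insert v V) i (k - 1) M)
        \<longlonglongrightarrow> L (insert v V) i k + (- x v) * L (insert v V) i (k - 1)"
      by (intro tendsto_add tendsto_mult tendsto_const L)
    ultimately show "T V i k \<longlonglongrightarrow> L (insert v V) i k - x v * L (insert v V) i (k - 1)"
      by simp
  qed
  \<comment> \<open>the column outside the matrix, expressed by the columns inside\<close>
  have wrap: "L V i (- 1) = - (\<Sum>l<n. signed_esym y n (Suc l) * L V i (int l))" for V i
  proof -
    have "(\<lambda>M. \<Sum>l\<le>n. signed_esym y n l * T V i (int l - 1) M) \<longlonglongrightarrow> 0"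
      using hsym_convolution_order_ge[OF x, where y = y and n = n and i = i and V = V]
      by (intro tendsto_zero_order_ge) (simp add: T_def add_diff_eq)
    moreover have "(\<lambda>M. \<Sum>l\<le>n. signed_esym y n l * T V i (int l - 1) M)
        \<longlonglongrightarrow> (\<Sum>l\<le>n. signed_esym y n l * L V i (int l - 1))"
      by (intro tendsto_sum tendsto_mult tendsto_const L)
    ultimately have "0 = (\<Sum>l\<le>n. signed_esym y n l * L V i (int l - 1))"
      by (rule LIMSEQ_unique)
    also have "\<dots> = L V i (- 1) + (\<Sum>l<n. signed_esym y n (Suc l) * L V i (int l))"
      by (subst sum.atMost_shift) simp
    finally show ?thesis by (simp add: eq_neg_iff_add_eq_0)
  qed
  have step: "det (?A V) = det (?A (insert v V)) * (\<Prod>j=1..n. 1 - x v * y j)"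
    if V: "finite V" "v \<notin> V" for V v
  proof -
    let ?Q = "mat n n (\<lambda>(l, j). (if l = j then 1 else 0) - (if Suc l = j then x v else 0)
      + (if j = 0 then x v * signed_esym y n (Suc l) else 0))"
    have "?A V = ?A (insert v V) * ?Q"
    proof (rule eq_matI)
      fix i j assume "i < dim_row (?A (insert v V) * ?Q)" "j < dim_col (?A (insert v V) * ?Q)"
      then have ij: "i < n" "j < n" by auto
      let ?a = "\<lambda>l. L (insert v V) i (int l)"
      have "(?A (insert v V) * ?Q) $$ (i, j) = (\<Sum>l<n. ?a l * ((if l = j then 1 else 0)
          - (if Suc l = j then x v else 0) + (if j = 0 then x v * signed_esym y n (Suc l) else 0)))"
        using ij by (simp add: scalar_prod_def lessThan_atLeast0)
      also have "\<dots> = ?a j - (if j = 0 then 0 else ?a (j - 1) * x v)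
          + (if j = 0 then x v * (\<Sum>l<n. ?a l * signed_esym y n (Suc l)) else 0)"
        using ij(2) by (rule sum_companion_column)
      also have "\<dots> = L V i (int j)"
      proof (cases j)
        case 0
        have "L V i 0 = ?a 0 - x v * L (insert v V) i (- 1)"
          using remove[OF V, of i 0] by simp
        then show ?thesis using 0 by (simp add: wrap mult.commute[of _ "signed_esym _ _ _"])
      next
        case (Suc j')
        then show ?thesis using ij remove[OF V, of i "int j"] by (simp add: mult.commute)
      qed
      finally show "?A V $$ (i, j) = (?A (insert v V) * ?Q) $$ (i, j)"
        using ij by simp
    qed auto
    moreover have "det ?Q = (\<Prod>j=1..n. 1 - x v * y j)"
    proof -
      have "det ?Q = 1 + (\<Sum>l<n. x v ^ Suc l * signed_esym y n (Suc l))"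
        using det_one_minus_companion[OF n] .
      also have "\<dots> = (\<Sum>l\<le>n. signed_esym y n l * x v ^ l)"
        by (subst sum.atMost_shift) (simp add: mult.commute)
      finally show ?thesis by (simp only: sum_signed_esym_power)
    qed
    ultimately show ?thesis
      by (simp add: det_mult[of _ n])
  qed
  have empty: "det (?A {}) = 1"
  proof -
    have entry: "L {} i (int j) = hsym {1..n} y (int i - int j)" if "j < n" for i j
    proof (rule LIMSEQ_unique[OF L])
      have "T {} i (int j) M = hsym {1..n} y (int i - int j)" for M
      proof -
        have "T {} i (int j) M = (\<Sum>s\<in>{- int j}. hsym {1..n} y (s + int i) * hsym {} x (s + int j))"
          unfolding T_def using that
          by (intro sum.mono_neutral_right) (auto simp: hsym_empty)
        then show ?thesis by simp
      qed
      then have "T {} i (int j) = (\<lambda>M. hsym {1..n} y (int i - int j))"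
        by (rule ext)
      then show "T {} i (int j) \<longlonglongrightarrow> hsym {1..n} y (int i - int j)"
        by (simp only: tendsto_const)
    qed
    have "det (?A {}) = prod_list (diag_mat (?A {}))"
      by (rule det_lower_triangular[of n]) (auto simp: entry)
    also have "diag_mat (?A {}) = map (\<lambda>_. 1) [0..<n]"
      by (auto simp: diag_mat_def entry)
    finally show ?thesis by (simp add: map_replicate_const)
  qed
  have prod: "det (?A {1..r}) * (\<Prod>i=1..r. \<Prod>j=1..n. 1 - x i * y j) = 1" for r
  proof (induction r)
    case 0
    then show ?case by (simp add: empty)
  next
    case (Suc r)
    have "{1..Suc r} = insert (Suc r) {1..r}" by auto
    then show ?case
      using Suc.IH step[of "{1..r}" "Suc r"] by (simp add: mult_ac)
  qed
  show ?thesis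
  proof (rule that)
    show "(\<lambda>M. det (mat n n (\<lambda>(i, j). \<Sum>s\<in>{1 - int n..int M}.
        hsym {1..n} y (s + int i) * hsym {1..n} x (s + int j)))) \<longlonglongrightarrow> det (?A {1..n})"
      by (rule tendsto_det_mps) (use L[of "{1..n}"] in \<open>simp add: T_def[abs_def]\<close>)
  qed (rule prod)
qed

lemma schur_order_ge:
  fixes x :: "nat \<Rightarrow> ('i, 'a :: comm_ring_1) mps"
  assumes x: "\<And>i. order_ge 1 (x i)" and "is_partition \<mu>" "k \<in> set \<mu>"
  shows "order_ge k (schur n x \<mu>)"
proof -
  obtain i where i: "i < length \<mu>" "\<mu> ! i = k"
    using assms(3) by (auto simp: in_set_conv_nth)
  \<comment> \<open>the first row of the Jacobi--Trudi matrix already has large degree\<close>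
  then have "\<mu> ! 0 \<ge> k"
    using assms(2) by (cases "i = 0") (auto simp: is_partition_def sorted_wrt_iff_nth_less)
  have "order_ge k (\<Prod>i=0..<length \<mu>. complete_sym n x (int (\<mu> ! i) - int i + int (p i)))" for p
  proof (rule order_ge_prod[of _ 0])
    have "order_ge (nat (int (\<mu> ! 0) + int (p 0))) (hsym {1..n} x (int (\<mu> ! 0) + int (p 0)))"
      by (rule order_ge_hsym) (rule x)
    then show "order_ge k (complete_sym n x (int (\<mu> ! 0) - int 0 + int (p 0)))"
      using \<open>\<mu> ! 0 \<ge> k\<close> by (auto simp: order_ge_def complete_sym_eq_hsym)
  qed (use i in auto)
  then show ?thesis
    by (auto simp: schur_def det_mat_eq intro!: order_ge_sum order_ge_mult_right)
qed

lemma finite_bounded_partitions: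
  "finite {\<mu>. is_partition \<mu> \<and> length \<mu> \<le> n \<and> (\<forall>k\<in>set \<mu>. k \<le> M)}"
proof (rule finite_subset)
  show "{\<mu>. is_partition \<mu> \<and> length \<mu> \<le> n \<and> (\<forall>k\<in>set \<mu>. k \<le> M)}
      \<subseteq> {\<mu>. set \<mu> \<subseteq> {..M} \<and> length \<mu> \<le> n}" by auto
qed (rule finite_lists_length_le, simp)

text \<open>A partition with a part larger than the degree of a monomial does not contribute to its coefficient, so that
finite sets of partitions containing all those with bounded parts give the same coefficient.\<close>

lemma has_sum_schur:
  fixes x y :: "nat \<Rightarrow> ('i, 'a :: comm_ring_1) mps"
  assumes x: "\<And>i. order_ge 1 (x i)"
    and lim: "(\<lambda>M. \<Sum>\<mu> | is_partition \<mu> \<and> length \<mu> \<le> n \<and> (\<forall>k\<in>set \<mu>. k \<le> M).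
      schur n x \<mu> * schur n y \<mu>) \<longlonglongrightarrow> l"
  shows "((\<lambda>\<mu>. schur n x \<mu> * schur n y \<mu>) has_sum l) {\<mu>. is_partition \<mu> \<and> length \<mu> \<le> n}"
  unfolding has_sum_def tendsto_mps_iff
proof
  fix m
  let ?f = "\<lambda>\<mu>. schur n x \<mu> * schur n y \<mu>"
  let ?P = "\<lambda>M. {\<mu>. is_partition \<mu> \<and> length \<mu> \<le> n \<and> (\<forall>k\<in>set \<mu>. k \<le> M)}"
  have "\<forall>\<^sub>F M in sequentially. mps_coeff (\<Sum>\<mu>\<in>?P M. ?f \<mu>) m = mps_coeff l m"
    using lim by (simp add: tendsto_mps_iff)
  then obtain M where M: "M \<ge> mon_deg m" "mps_coeff (\<Sum>\<mu>\<in>?P M. ?f \<mu>) m = mps_coeff l m"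
    unfolding eventually_sequentially by (meson nle_le)
  show "\<forall>\<^sub>F F in finite_subsets_at_top {\<mu>. is_partition \<mu> \<and> length \<mu> \<le> n}.
      mps_coeff (sum ?f F) m = mps_coeff l m"
    unfolding eventually_finite_subsets_at_top
  proof (intro exI[of _ "?P M"] conjI allI impI)
    fix F assume F: "finite F \<and> ?P M \<subseteq> F \<and> F \<subseteq> {\<mu>. is_partition \<mu> \<and> length \<mu> \<le> n}"
    have "(\<Sum>\<mu>\<in>F. mps_coeff (?f \<mu>) m) = (\<Sum>\<mu>\<in>?P M. mps_coeff (?f \<mu>) m)"
    proof (rule sum.mono_neutral_right)
      show "\<forall>\<mu>\<in>F - ?P M. mps_coeff (?f \<mu>) m = 0"
      proof
        fix \<mu> assume \<mu>: "\<mu> \<in> F - ?P M"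
        then obtain k where k: "k \<in> set \<mu>" "k > M" using F by force
        have "order_ge k (?f \<mu>)"
          by (rule order_ge_mult_left, rule schur_order_ge) (use x k \<mu> F in auto)
        then show "mps_coeff (?f \<mu>) m = 0"
          using k(2) M(1) by (simp add: order_ge_def)
      qed
    qed (use F in auto)
    then show "mps_coeff (sum ?f F) m = mps_coeff l m"
      using M(2) by simp
  qed (auto simp: finite_bounded_partitions)
qed

section \<open>Operator series acting on series of vectors\<close>

text \<open>The action of an operator series on a series of vectors. By \<open>op_prod_eq_foldr_act\<close> a product of operator series
can be evaluated on the vacuum one factor at a time. This replaces infinite products by their values
on the vectors that actually occur, without assuming anything about other vectors.\<close>

definition act :: "('i, 'v :: comm_monoid_add) opser \<Rightarrow> (('i \<Rightarrow>\<^sub>0 nat) \<Rightarrow> 'v) \<Rightarrow> ('i \<Rightarrow>\<^sub>0 nat) \<Rightarrow> 'v" where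
  "act P \<Psi> m = (\<Sum>(p, q)\<in>splits m. P p (\<Psi> q))"

definition const_series :: "'v \<Rightarrow> ('i \<Rightarrow>\<^sub>0 nat) \<Rightarrow> 'v :: zero" where
  "const_series v = (\<lambda>m. if m = 0 then v else 0)"

lemma sum_splits_left:
  fixes f :: "('i \<Rightarrow>\<^sub>0 nat) \<Rightarrow> 'b :: comm_monoid_add"
  shows "(\<Sum>(p, q)\<in>splits m. if p = 0 then f q else 0) = f m"
proof -
  have "(\<Sum>(p, q)\<in>splits m. if p = 0 then f q else 0) = (\<Sum>(p, q)\<in>{(0 :: 'i \<Rightarrow>\<^sub>0 nat, m)}. if p = 0 then f q else 0)"
    by (rule sum.mono_neutral_right, simp) (auto simp: splits_def split: if_splits)
  then show ?thesis by simp
qed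

lemma sum_splits_right:
  fixes f :: "('i \<Rightarrow>\<^sub>0 nat) \<Rightarrow> 'b :: comm_monoid_add"
  shows "(\<Sum>(p, q)\<in>splits m. if q = 0 then f p else 0) = f m"
proof -
  have "(\<Sum>(p, q)\<in>splits m. if q = 0 then f p else 0) = (\<Sum>(p, q)\<in>{(m, 0 :: 'i \<Rightarrow>\<^sub>0 nat)}. if q = 0 then f p else 0)"
    by (rule sum.mono_neutral_right, simp) (auto simp: splits_def split: if_splits)
  then show ?thesis by simp
qed

lemma act_cong: "(\<And>p q. P p (\<Psi> q) = Q p (\<Psi> q)) \<Longrightarrow> act P \<Psi> = act Q \<Psi>"
  by (simp add: act_def fun_eq_iff)

lemma act_op_one [simp]: "act op_one \<Psi> = \<Psi>"
  by (simp add: act_def op_one_def sum_splits_left fun_eq_iff)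

lemma act_const_series:
  assumes "\<And>m. P m 0 = 0"
  shows "act P (const_series v) = (\<lambda>m. P m v)"
proof
  fix m
  have "act P (const_series v) m = (\<Sum>(p, q)\<in>splits m. if q = 0 then P p v else 0)"
    using assms by (auto simp: act_def const_series_def intro!: sum.cong)
  then show "act P (const_series v) m = P m v" by (simp add: sum_splits_right)
qed

lemma op_prod_eq_foldr_act: "(\<lambda>m. op_prod Ps m v) = foldr act Ps (const_series v)"
proof (induction Ps)
  case Nil
  then show ?case by (simp add: op_prod_def op_one_def const_series_def)
next
  case (Cons P Ps)
  then show ?case
    by (simp add: op_prod_def op_mult_def act_def[abs_def] fun_eq_iff)
qed

text \<open>A limit of operators defined by \<open>op_lim\<close> need not be additive on all vectors; the finite products are.\<close>

definition op_additive :: "('i, 'v :: ab_group_add) opser \<Rightarrow> bool" where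
  "op_additive P \<longleftrightarrow> (\<forall>p. Modules.additive (P p))"

lemma op_additiveD:
  assumes "op_additive P"
  shows "P p (u + v) = P p u + P p v" "P p 0 = 0" "P p (- u) = - P p u"
    "P p (sum f A) = (\<Sum>a\<in>A. P p (f a))"
proof -
  interpret Modules.additive "P p" using assms by (simp add: op_additive_def)
  show "P p (u + v) = P p u + P p v" "P p 0 = 0" "P p (- u) = - P p u"
    "P p (sum f A) = (\<Sum>a\<in>A. P p (f a))"
    by (simp_all add: add zero minus sum)
qed

lemma act_act:
  assumes "op_additive P"
  shows "act P (act Q \<Psi>) = act (op_mult P Q) \<Psi>"
proof
  fix m
  have "act P (act Q \<Psi>) m = (\<Sum>(p, qr)\<in>splits m. \<Sum>(q, r)\<in>splits qr. P p (Q q (\<Psi> r)))"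
    by (simp add: act_def op_additiveD[OF assms] case_prod_unfold)
  also have "\<dots> = (\<Sum>(s, t)\<in>(SIGMA s:splits m. splits (snd s)). P (fst s) (Q (fst t) (\<Psi> (snd t))))"
    by (subst sum.Sigma[symmetric]) (auto simp: case_prod_unfold)
  also have "\<dots> = (\<Sum>(s, t)\<in>(SIGMA s:splits m. splits (fst s)). P (fst t) (Q (snd t) (\<Psi> (snd s))))"
    by (rule sum.reindex_bij_witness
          [where j = "\<lambda>((p, qr), (q, r)). ((p + q, r), (p, q))"
            and i = "\<lambda>((pq, r), (p, q)). ((p, q + r), (q, r))"])
       (auto simp: splits_def add.assoc)
  also have "\<dots> = (\<Sum>(pq, r)\<in>splits m. \<Sum>(p, q)\<in>splits pq. P p (Q q (\<Psi> r)))"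
    by (subst sum.Sigma[symmetric]) (auto simp: case_prod_unfold)
  also have "\<dots> = act (op_mult P Q) \<Psi> m"
    by (simp add: act_def op_mult_def)
  finally show "act P (act Q \<Psi>) m = act (op_mult P Q) \<Psi> m" .
qed

lemma act_op_prod:
  assumes "\<And>P. P \<in> set Ps \<Longrightarrow> op_additive P"
  shows "act (op_prod Ps) \<Psi> = foldr act Ps \<Psi>"
  using assms
proof (induction Ps)
  case (Cons P Ps)
  have "act (op_prod (P # Ps)) \<Psi> = act P (act (op_prod Ps) \<Psi>)"
    using Cons.prems by (simp add: op_prod_def act_act)
  then show ?case using Cons by simp
qed (simp add: op_prod_def)

lemma act_commute:
  assumes "op_additive P" "op_additive Q" "\<And>p q v. P p (Q q v) = Q q (P p v)"
  shows "act P (act Q \<Psi>) = act Q (act P \<Psi>)"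
proof -
  have "op_mult P Q = op_mult Q P"
    unfolding op_mult_def fun_eq_iff
    by (intro allI sum.reindex_bij_witness[of _ prod.swap prod.swap])
       (auto simp: splits_def add.commute assms(3))
  then show ?thesis using assms(1,2) by (simp add: act_act)
qed

lemma act_add:
  assumes "op_additive P"
  shows "act P (\<lambda>m. \<Psi> m + \<Xi> m) = (\<lambda>m. act P \<Psi> m + act P \<Xi> m)"
  by (simp add: act_def op_additiveD[OF assms] sum.distrib case_prod_unfold fun_eq_iff)

lemma act_zero:
  assumes "op_additive P"
  shows "act P (\<lambda>m. 0) = (\<lambda>m. 0)"
  by (simp add: act_def op_additiveD[OF assms] case_prod_unfold fun_eq_iff)

lemma op_lim_eqI:
  assumes "\<And>K. K \<ge> K0 \<Longrightarrow> P K m v = w"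
  shows "op_lim P m v = w"
  unfolding op_lim_def
proof (rule the_equality)
  show ev: "\<forall>\<^sub>F K in sequentially. P K m v = w"
    using assms by (auto simp: eventually_sequentially)
  fix w' assume "\<forall>\<^sub>F K in sequentially. P K m v = w'"
  with ev have "\<forall>\<^sub>F K in sequentially. w' = w"
    by eventually_elim simp
  then show "w' = w" by simp
qed

lemma minus_single_eq_single:
  fixes m :: "'i \<Rightarrow>\<^sub>0 nat"
  assumes "Poly_Mapping.lookup m z \<noteq> 0" "m - Poly_Mapping.single z 1 = Poly_Mapping.single z n"
  shows "m = Poly_Mapping.single z (Suc n)"
proof (rule poly_mapping_eqI)
  fix k
  show "Poly_Mapping.lookup m k = Poly_Mapping.lookup (Poly_Mapping.single z (Suc n)) k"
    using arg_cong[OF assms(2), of "\<lambda>f. Poly_Mapping.lookup f k"] assms(1)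
    by (auto simp: lookup_minus lookup_single when_def split: if_splits)
qed

section \<open>Exponentials of bilinear operators\<close>

context charged_free_bosons
begin

definition a_op :: "int \<Rightarrow> 'v \<Rightarrow> 'v" where "a_op i = \<phi> (- i)"

abbreviation (input) b_op :: "int \<Rightarrow> 'v \<Rightarrow> 'v" where "b_op i \<equiv> \<phi>s i"

lemma a_op_linear:
  "a_op i (u + v) = a_op i u + a_op i v" "a_op i (scale c v) = scale c (a_op i v)"
  "a_op i 0 = 0" "a_op i (- u) = - a_op i u" "a_op i (u - v) = a_op i u - a_op i v"
  "a_op i (sum f A) = (\<Sum>x\<in>A. a_op i (f x))"
proof -
  interpret Vector_Spaces.linear scale scale "\<phi> (- i)" by (rule linear_\<phi>)
  show "a_op i (u + v) = a_op i u + a_op i v" "a_op i (scale c v) = scale c (a_op i v)"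
    "a_op i 0 = 0" "a_op i (- u) = - a_op i u" "a_op i (u - v) = a_op i u - a_op i v"
    "a_op i (sum f A) = (\<Sum>x\<in>A. a_op i (f x))"
    by (simp_all add: a_op_def add scale zero neg diff sum)
qed

lemma b_op_linear:
  "b_op i (u + v) = b_op i u + b_op i v" "b_op i (scale c v) = scale c (b_op i v)"
  "b_op i 0 = 0" "b_op i (- u) = - b_op i u" "b_op i (u - v) = b_op i u - b_op i v"
  "b_op i (sum f A) = (\<Sum>x\<in>A. b_op i (f x))"
proof -
  interpret Vector_Spaces.linear scale scale "\<phi>s i" by (rule linear_\<phi>s)
  show "b_op i (u + v) = b_op i u + b_op i v" "b_op i (scale c v) = scale c (b_op i v)"
    "b_op i 0 = 0" "b_op i (- u) = - b_op i u" "b_op i (u - v) = b_op i u - b_op i v"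
    "b_op i (sum f A) = (\<Sum>x\<in>A. b_op i (f x))"
    by (simp_all add: add scale zero neg diff sum)
qed

lemma a_a: "a_op i (a_op j v) = a_op j (a_op i v)"
  using comm_\<phi>_\<phi>[of "- i" "- j" v] by (simp add: a_op_def)

lemma b_b: "b_op i (b_op j v) = b_op j (b_op i v)"
  using comm_\<phi>s_\<phi>s[of i j v] by simp

lemma b_a: "b_op j (a_op i v) = a_op i (b_op j v) - (if i = j then v else 0)"
  using comm_\<phi>_\<phi>s[of "- i" j v] by (simp add: a_op_def algebra_simps)

lemma b_a_commute: "i \<noteq> j \<Longrightarrow> b_op j (a_op i v) = a_op i (b_op j v)"
  by (simp add: b_a)

lemma a_vac: "i \<le> 0 \<Longrightarrow> a_op i vac = 0"
  by (simp add: a_op_def \<phi>_vac)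

lemma b_vac: "j \<ge> 1 \<Longrightarrow> b_op j vac = 0"
  using \<phi>s_vac[of "j - 1"] by simp

lemma dvac_b: "j \<le> 0 \<Longrightarrow> dvac (b_op j v) = 0"
  using dvac_\<phi>s[of "j - 1" v] by simp

lemma dvac_linear:
  "dvac (u + v) = dvac u + dvac v" "dvac (scale c v) = c * dvac v" "dvac 0 = 0"
  "dvac (sum f A) = (\<Sum>x\<in>A. dvac (f x))"
proof -
  interpret Vector_Spaces.linear scale "(*)" dvac by (rule linear_dvac)
  show "dvac (u + v) = dvac u + dvac v" "dvac (scale c v) = c * dvac v" "dvac 0 = 0"
    "dvac (sum f A) = (\<Sum>x\<in>A. dvac (f x))"
    by (simp_all add: add scale zero sum)
qed

definition bilin :: "int \<Rightarrow> int \<Rightarrow> 'v \<Rightarrow> 'v" where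
  "bilin p q v = a_op p (b_op q v)"

definition factor :: "'i \<times> int \<times> int \<Rightarrow> ('i, 'v) opser" where
  "factor = (\<lambda>(z, p, q). op_exp scale z (bilin p q))"

lemma bilin_linear:
  "bilin p q (u + v) = bilin p q u + bilin p q v" "bilin p q (scale c v) = scale c (bilin p q v)"
  "bilin p q 0 = 0"
  by (simp_all add: bilin_def a_op_linear b_op_linear)

lemma bilin_pow_linear:
  "(bilin p q ^^ n) (u + v) = (bilin p q ^^ n) u + (bilin p q ^^ n) v"
  "(bilin p q ^^ n) (scale c v) = scale c ((bilin p q ^^ n) v)"
  "(bilin p q ^^ n) 0 = 0"
  by (induction n) (simp_all add: bilin_linear)

lemma op_exp_single:
  "op_exp scale z A (Poly_Mapping.single z n) v = scale (1 / fact n) ((A ^^ n) v)"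
  by (simp add: op_exp_def)

lemma op_exp_other:
  "(\<And>n. m \<noteq> Poly_Mapping.single z n) \<Longrightarrow> op_exp scale z A m v = 0"
  by (simp add: op_exp_def Let_def)

lemma factor_linear:
  "factor w m (u + v) = factor w m u + factor w m v"
  "factor w m (scale c v) = scale c (factor w m v)"
  by (cases w, simp add: factor_def op_exp_def Let_def bilin_pow_linear scale_right_distrib
      scale_left_commute)+

lemma op_additive_factor [simp]: "op_additive (factor w)"
  by (auto simp: op_additive_def factor_linear intro: additive.intro)

lemma factor_eq_op_one:
  assumes "bilin p q v = 0"
  shows "factor (z, p, q) m v = op_one m v"
proof -
  have "(bilin p q ^^ Suc n) v = 0" for n
    by (simp only: funpow_Suc_right comp_def assms bilin_pow_linear)
  then have "(bilin p q ^^ n) v = (if n = 0 then v else 0)" for n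
    by (cases n) auto
  then show ?thesis
    by (auto simp: factor_def op_exp_def op_one_def Let_def)
qed

lemma act_factor_trivial:
  assumes "\<And>m. bilin p q (\<Psi> m) = 0"
  shows "act (factor (z, p, q)) \<Psi> = \<Psi>"
proof -
  have "act (factor (z, p, q)) \<Psi> = act op_one \<Psi>"
    by (rule act_cong) (rule factor_eq_op_one[OF assms])
  then show ?thesis by simp
qed

lemma b_bilin:
  assumes "p \<noteq> q"
  shows "b_op j (bilin p q v) = bilin p q (b_op j v) - (if j = p then b_op q v else 0)"
  using assms by (simp add: bilin_def b_a b_b[of j q] b_op_linear)

lemma b_bilin_pow_commute:
  assumes "p \<noteq> q" "j \<noteq> p"
  shows "b_op j ((bilin p q ^^ n) v) = (bilin p q ^^ n) (b_op j v)"
  by (induction n) (simp_all add: b_bilin[OF assms(1)] assms(2))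

text \<open>\<open>b\<^sub>p\<close> acts on powers of \<open>a\<^sub>p b\<^sub>q\<close> like a derivation with \<open>[b\<^sub>p, a\<^sub>p b\<^sub>q] = - b\<^sub>q\<close>.\<close>

lemma b_bilin_pow_Suc:
  assumes "p \<noteq> q"
  shows "b_op p ((bilin p q ^^ Suc n) v)
    = (bilin p q ^^ Suc n) (b_op p v) - scale (of_nat (Suc n)) ((bilin p q ^^ n) (b_op q v))"
proof (induction n)
  case 0
  then show ?case by (simp add: b_bilin[OF assms])
next
  case (Suc n)
  have neg: "bilin p q (u - w) = bilin p q u - bilin p q w" for u w
    by (simp add: bilin_def a_op_linear b_op_linear)
  have "b_op p ((bilin p q ^^ Suc (Suc n)) v)
      = bilin p q (b_op p ((bilin p q ^^ Suc n) v)) - b_op q ((bilin p q ^^ Suc n) v)"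
    using b_bilin[OF assms, of p "(bilin p q ^^ Suc n) v"] by simp
  also have "b_op q ((bilin p q ^^ Suc n) v) = (bilin p q ^^ Suc n) (b_op q v)"
    using assms by (intro b_bilin_pow_commute) auto
  also have "bilin p q (b_op p ((bilin p q ^^ Suc n) v)) = (bilin p q ^^ Suc (Suc n)) (b_op p v)
      - scale (of_nat (Suc n)) ((bilin p q ^^ Suc n) (b_op q v))"
    by (simp only: Suc.IH neg bilin_linear) simp
  finally have eq: "b_op p ((bilin p q ^^ Suc (Suc n)) v) = (bilin p q ^^ Suc (Suc n)) (b_op p v)
      - scale (of_nat (Suc n)) ((bilin p q ^^ Suc n) (b_op q v)) - (bilin p q ^^ Suc n) (b_op q v)" .
  have "scale (of_nat (Suc (Suc n))) u = scale (of_nat (Suc n)) u + u" for u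
    by (subst of_nat_Suc) (simp only: scale_left_distrib scale_one add.commute)
  then show ?case
    unfolding eq by (simp only: diff_diff_eq)
qed

text \<open>The module structure of the series of vectors over the power series.\<close>

definition smul :: "('i, 'a) mps \<Rightarrow> (('i \<Rightarrow>\<^sub>0 nat) \<Rightarrow> 'v) \<Rightarrow> ('i \<Rightarrow>\<^sub>0 nat) \<Rightarrow> 'v" where
  "smul f = act (\<lambda>p. scale (mps_coeff f p))"

lemma op_additive_scale [simp]: "op_additive (\<lambda>p. scale (c p))"
  by (auto simp: op_additive_def scale_right_distrib intro: additive.intro)

lemma smul_var:
  "smul (mps_var z) \<Psi> m = (if Poly_Mapping.lookup m z = 0 then 0
     else \<Psi> (m - Poly_Mapping.single z 1))"
proof (cases "Poly_Mapping.lookup m z = 0")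
  case True
  have "(p, q) \<in> splits m \<Longrightarrow> p \<noteq> Poly_Mapping.single z 1" for p q
    using True by (auto simp: splits_def lookup_add)
  then show ?thesis
    using True by (auto simp: smul_def act_def mps_var_def intro!: sum.neutral)
next
  case False
  let ?s = "Poly_Mapping.single z (1 :: nat)"
  have m: "?s + (m - ?s) = m"
    using False by (intro poly_mapping_eqI) (auto simp: lookup_add lookup_minus lookup_single when_def)
  have "smul (mps_var z) \<Psi> m = (\<Sum>(p, q)\<in>{(?s, m - ?s)}. scale (mps_coeff (mps_var z) p) (\<Psi> q))"
    unfolding smul_def act_def
    by (rule sum.mono_neutral_right, simp) (use m in \<open>auto simp: splits_def mps_var_def split: if_splits\<close>)
  then show ?thesis using False by (simp add: mps_var_def)
qed

lemma act_factor_smul: "act (factor w) (smul f \<Psi>) = smul f (act (factor w) \<Psi>)"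
  unfolding smul_def by (rule act_commute) (simp_all add: factor_linear)

lemma b_factor_commute:
  assumes "p \<noteq> q" "j \<noteq> p"
  shows "b_op j (factor (z, p, q) m v) = factor (z, p, q) m (b_op j v)"
  by (simp add: factor_def op_exp_def Let_def b_op_linear b_bilin_pow_commute[OF assms])

lemma b_factor:
  assumes "p \<noteq> q"
  shows "b_op p (factor (z, p, q) m v) = factor (z, p, q) m (b_op p v)
    - smul (mps_var z) (\<lambda>m. factor (z, p, q) m (b_op q v)) m"
proof (cases "\<exists>n. m = Poly_Mapping.single z n")
  case True
  then obtain n where n: "m = Poly_Mapping.single z n" by blast
  show ?thesis
  proof (cases n)
    case 0
    then show ?thesis
      using op_exp_single[of z _ 0] by (simp add: n factor_def smul_var)
  next
    case (Suc k)
    have "1 / fact (Suc k) * (of_nat (Suc k) :: 'a) = 1 / fact k"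
      by (simp add: fact_Suc del: of_nat_Suc)
    moreover have "m - Poly_Mapping.single z 1 = Poly_Mapping.single z k"
      unfolding n Suc by (simp flip: single_diff)
    ultimately show ?thesis
      unfolding n Suc factor_def prod.case op_exp_single b_op_linear b_bilin_pow_Suc[OF assms] smul_var
      by (simp add: n Suc scale_right_diff_distrib op_exp_single del: funpow.simps of_nat_Suc fact_Suc)
  qed
next
  case False
  then have "m - Poly_Mapping.single z 1 \<noteq> Poly_Mapping.single z n" if "Poly_Mapping.lookup m z \<noteq> 0" for n
    using minus_single_eq_single[OF that] by blast
  then show ?thesis
    using False by (auto simp: factor_def op_exp_other b_op_linear smul_var)
qed

text \<open>\<open>b\<^sub>j E = E b\<^sub>j - \<delta>\<^sub>j\<^sub>p z E b\<^sub>q\<close> for \<open>E = exp (z a\<^sub>p b\<^sub>q)\<close>. This is the source of the row operations.\<close>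

lemma b_act_factor:
  assumes "p \<noteq> q"
  shows "(\<lambda>m. b_op j (act (factor (z, p, q)) \<Psi> m)) = (\<lambda>m. act (factor (z, p, q)) (\<lambda>m. b_op j (\<Psi> m)) m
    - (if j = p then smul (mps_var z) (act (factor (z, p, q)) (\<lambda>m. b_op q (\<Psi> m))) m else 0))"
proof (cases "j = p")
  case False
  then show ?thesis
    by (simp add: act_def b_op_linear case_prod_unfold b_factor_commute[OF assms])
next
  case True
  have "smul (mps_var z) (act (factor (z, p, q)) (\<lambda>m. b_op q (\<Psi> m))) m
      = (\<Sum>(s, t)\<in>splits m. smul (mps_var z) (\<lambda>m. factor (z, p, q) m (b_op q (\<Psi> t))) s)" for m
    unfolding smul_def by (subst act_act) (simp_all add: act_def op_mult_def)
  then show ?thesis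
    using True by (simp add: act_def b_op_linear case_prod_unfold b_factor[OF assms] sum_subtractf)
qed

lemma a_act_factor_commute:
  assumes "q \<noteq> l"
  shows "a_op l (act (factor (z, p, q)) \<Psi> m) = act (factor (z, p, q)) (\<lambda>m. a_op l (\<Psi> m)) m"
proof -
  have pow: "a_op l ((bilin p q ^^ n) v) = (bilin p q ^^ n) (a_op l v)" for n v
  proof (induction n)
    case (Suc n)
    have "a_op l (bilin p q u) = bilin p q (a_op l u)" for u
      using assms by (simp add: bilin_def a_a[of l p] b_a)
    then show ?case using Suc by simp
  qed simp
  show ?thesis
    unfolding act_def a_op_linear case_prod_unfold
    by (rule sum.cong) (auto simp: factor_def op_exp_def Let_def a_op_linear pow)
qed

end

section \<open>The vacuum expectation value as the reciprocal of a determinant\<close>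

context charged_free_bosons
begin

definition vev_series :: "(('i \<Rightarrow>\<^sub>0 nat) \<Rightarrow> 'v) \<Rightarrow> ('i, 'a) mps" where
  "vev_series \<Psi> = Abs_mps (\<lambda>m. dvac (\<Psi> m))"

lemma vev_series_add: "vev_series (\<lambda>m. \<Psi> m + \<Xi> m) = vev_series \<Psi> + vev_series \<Xi>"
  by (rule mps_eqI) (simp add: vev_series_def plus_mps_def dvac_linear)

lemma vev_series_smul: "vev_series (smul f \<Psi>) = f * vev_series \<Psi>"
  by (rule mps_eqI)
     (simp add: vev_series_def times_mps_def smul_def act_def dvac_linear case_prod_unfold)

text \<open>\<open>L\<close> stands for \<open>\<Psi> \<mapsto> \<langle>0|W \<Psi>\<rangle>\<close>, and \<open>S k j\<close> is the coefficient of \<open>b\<^sub>j\<close> after \<open>b\<^sub>k\<close> has been moved through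
the word \<open>W\<close>. Row \<open>i\<close> and column \<open>k\<close> of the block correspond to the indices \<open>- i\<close> and \<open>- k\<close>, both
at most 0.\<close>

definition row_invariant :: "nat \<Rightarrow> nat \<Rightarrow> ((('i \<Rightarrow>\<^sub>0 nat) \<Rightarrow> 'v) \<Rightarrow> ('i, 'a) mps)
    \<Rightarrow> (int \<Rightarrow> int \<Rightarrow> ('i, 'a) mps) \<Rightarrow> bool" where
  "row_invariant M N L S \<longleftrightarrow>
     (\<forall>\<Psi> \<Xi>. L (\<lambda>m. \<Psi> m + \<Xi> m) = L \<Psi> + L \<Xi>) \<and>
     (\<forall>z \<Psi>. L (smul (mps_var z) \<Psi>) = mps_var z * L \<Psi>) \<and>
     (\<forall>k\<in>{1 - int N..0}. \<forall>\<Psi>. (\<Sum>j\<in>{1 - int N..int M}. S k j * L (\<lambda>m. b_op j (\<Psi> m))) = 0) \<and>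
     det (mat N N (\<lambda>(i, k). S (- int k) (- int i))) * L (const_series vac) = 1"

lemma row_invariant_Nil:
  "row_invariant M N (vev_series :: (('i \<Rightarrow>\<^sub>0 nat) \<Rightarrow> 'v) \<Rightarrow> ('i, 'a) mps) (\<lambda>k j. if j = k then 1 else 0)"
  unfolding row_invariant_def
proof (intro conjI allI ballI)
  fix k and \<Psi> :: "('i \<Rightarrow>\<^sub>0 nat) \<Rightarrow> 'v" assume k: "k \<in> {1 - int N..0}"
  then have "(\<Sum>j\<in>{1 - int N..int M}. (if j = k then 1 else 0) * vev_series (\<lambda>m. b_op j (\<Psi> m)))
      = vev_series (\<lambda>m. b_op k (\<Psi> m))"
    by (simp add: if_distrib[of "\<lambda>c. c * _"] cong: if_cong)
  also have "\<dots> = 0"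
    using k by (intro mps_eqI) (simp add: vev_series_def dvac_b zero_mps_def)
  finally show "(\<Sum>j\<in>{1 - int N..int M}. (if j = k then 1 else 0) * vev_series (\<lambda>m. b_op j (\<Psi> m))) = 0" .
next
  have "mat N N (\<lambda>(i, k). if - int i = - int k then 1 else (0 :: ('i, 'a) mps)) = 1\<^sub>m N"
    by (intro eq_matI) auto
  moreover have "vev_series (const_series vac) = (1 :: ('i, 'a) mps)"
    by (rule mps_eqI) (simp add: vev_series_def const_series_def one_mps_def dvac_vac dvac_linear)
  ultimately show "det (mat N N (\<lambda>(i, k). if - int i = - int k then 1 else 0))
      * vev_series (const_series vac) = (1 :: ('i, 'a) mps)"
    by simp
qed (simp_all add: vev_series_add vev_series_smul)

lemma bilin_vac:
  assumes "p \<noteq> q" "p \<le> 0 \<or> q \<ge> 1"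
  shows "bilin p q vac = 0"
proof (cases "q \<ge> 1")
  case True
  then show ?thesis by (simp add: bilin_def b_vac a_op_linear)
next
  case False
  then have "a_op p vac = 0" using assms by (simp add: a_vac)
  then show ?thesis
    using assms(1) b_a_commute[of p q vac] by (simp add: bilin_def b_op_linear)
qed

lemma act_factor_const_vac:
  assumes "p \<noteq> q" "p \<le> 0 \<or> q \<ge> 1"
  shows "act (factor (z, p, q)) (const_series vac) = const_series vac"
  by (rule act_factor_trivial) (simp add: const_series_def bilin_vac[OF assms] bilin_linear)

text \<open>The series \<open>\<Phi> = \<Sum>\<^sub>n z\<^sup>n / (n + 1)! (a\<^sub>p b\<^sub>q)\<^sup>n a\<^sub>p |0\<rangle>\<close>, obtained from \<open>exp (z a\<^sub>p b\<^sub>q)|0\<rangle> - |0\<rangle>\<close> by splitting off one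
factor \<open>z b\<^sub>q\<close>.\<close>

definition pair_series :: "'i \<Rightarrow> int \<Rightarrow> int \<Rightarrow> ('i \<Rightarrow>\<^sub>0 nat) \<Rightarrow> 'v" where
  "pair_series z p q m = (let n = Poly_Mapping.lookup m z in
     if m = Poly_Mapping.single z n then scale (1 / fact (Suc n)) ((bilin p q ^^ n) (a_op p vac)) else 0)"

lemma act_factor_vac: "act (factor w) (const_series vac) = (\<lambda>m. factor w m vac)"
  by (rule act_const_series) (rule op_additiveD[OF op_additive_factor])

lemma factor_vac_eq_pair_series:
  assumes "p \<noteq> q"
  shows "factor (z, p, q) m vac
    = const_series vac m + smul (mps_var z) (\<lambda>m. b_op q (pair_series z p q m)) m"
proof (cases "\<exists>n. m = Poly_Mapping.single z n")
  case True
  then obtain n where n: "m = Poly_Mapping.single z n" by blast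
  show ?thesis
  proof (cases n)
    case 0
    then show ?thesis
      using op_exp_single[of z _ 0] by (simp add: n factor_def smul_var const_series_def)
  next
    case (Suc k)
    have "m - Poly_Mapping.single z 1 = Poly_Mapping.single z k"
      unfolding n Suc by (simp flip: single_diff)
    moreover have "m \<noteq> 0" using n Suc by (metis lookup_single_eq lookup_zero nat.distinct(1))
    moreover have "b_op q ((bilin p q ^^ k) (a_op p vac)) = (bilin p q ^^ Suc k) vac"
      using assms b_bilin_pow_commute[of p q q k "a_op p vac"] b_a_commute[of p q vac]
      by (simp add: bilin_def funpow_swap1)
    ultimately show ?thesis
      using n Suc by (simp add: smul_var const_series_def pair_series_def b_op_linear factor_def op_exp_single
          del: funpow.simps fact_Suc)
  qed
next
  case False
  then have "m \<noteq> 0" by (metis single_zero)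
  have "pair_series z p q (m - Poly_Mapping.single z 1) = 0" if "Poly_Mapping.lookup m z \<noteq> 0"
    using False minus_single_eq_single[OF that] by (auto simp: pair_series_def Let_def)
  then show ?thesis
    using False \<open>m \<noteq> 0\<close> by (simp add: factor_def op_exp_other smul_var const_series_def b_op_linear)
qed

text \<open>Moving \<open>b\<^sub>p\<close> to the vacuum produces \<open>n + 1\<close> equal terms, one for each \<open>a\<^sub>p\<close>, which cancels the \<open>n + 1\<close> in the
denominator and restores the exponential series.\<close>

lemma b_pair_series:
  assumes pq: "p \<noteq> q" and p: "p \<ge> 1" and j: "j \<ge> 1"
  shows "b_op j (pair_series z p q m) = (if j = p then - factor (z, p, q) m vac else 0)"
proof (cases "j = p")
  case False
  then have "b_op j ((bilin p q ^^ n) (a_op p vac)) = 0" for n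
    using b_vac[OF j] by (simp add: b_bilin_pow_commute[OF pq] b_a_commute a_op_linear bilin_pow_linear)
  then show ?thesis
    using False by (simp add: pair_series_def Let_def b_op_linear)
next
  case True
  have ba: "b_op p (a_op p vac) = - vac"
    using b_vac[OF p] by (simp add: b_a a_op_linear)
  have neg: "(bilin p q ^^ n) (- u) = - ((bilin p q ^^ n) u)" for n u
    using bilin_pow_linear(2)[of n p q "- 1" u] by simp
  have pow: "b_op p ((bilin p q ^^ n) (a_op p vac)) = - scale (of_nat (Suc n)) ((bilin p q ^^ n) vac)" for n
  proof (cases n)
    case 0
    then show ?thesis by (simp add: ba)
  next
    case (Suc k)
    have "b_op q (a_op p vac) = bilin p q vac"
      using pq by (simp add: bilin_def b_a_commute)
    then have "(bilin p q ^^ k) (b_op q (a_op p vac)) = (bilin p q ^^ Suc k) vac"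
      by (simp add: funpow_swap1)
    then have "b_op p ((bilin p q ^^ Suc k) (a_op p vac))
        = - (bilin p q ^^ Suc k) vac - scale (of_nat (Suc k)) ((bilin p q ^^ Suc k) vac)"
      by (simp only: b_bilin_pow_Suc[OF pq] ba neg)
    also have "\<dots> = - scale (of_nat (Suc (Suc k))) ((bilin p q ^^ Suc k) vac)"
      by (subst of_nat_Suc[of "Suc k"]) (simp only: scale_left_distrib scale_one minus_add_distrib diff_conv_add_uminus)
    finally show ?thesis using Suc by simp
  qed
  have "1 / fact (Suc n) * (of_nat (Suc n) :: 'a) = 1 / fact n" for n
    by (simp add: fact_Suc del: of_nat_Suc)
  then show ?thesis
    using True by (auto simp: pair_series_def Let_def b_op_linear pow factor_def op_exp_def
        scale_minus_right simp del: fact_Suc of_nat_Suc)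
qed

text \<open>The relations for the longer word follow from \<open>b_act_factor\<close>. If \<open>p \<le> 0\<close> or \<open>q \<ge> 1\<close>, the new factor fixes the
vacuum, and the row operation adds a multiple of one row of the block to another or changes a row
outside the block. Otherwise the relations applied to \<open>pair_series\<close> are a linear system with the block as
its matrix, because \<open>b\<^sub>j\<close> with \<open>j \<ge> 1\<close> contributes only for \<open>j = p\<close>.\<close>

lemma row_invariant_step:
  assumes inv: "row_invariant M N L S" and N: "N \<ge> 1"
    and p: "p \<in> {1 - int N..int M}" and q: "q \<in> {1 - int N..int M}" and pq: "p \<noteq> q"
  shows "row_invariant M N (\<lambda>\<Psi>. L (act (factor (z, p, q)) \<Psi>)) (\<lambda>k. row_op (mps_var z) p q (S k))"
proof -
  let ?E = "act (factor (z, p, q))"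
  let ?I = "{1 - int N..int M}"
  let ?z = "mps_var z"
  have L_add: "L (\<lambda>m. \<Psi> m + \<Xi> m) = L \<Psi> + L \<Xi>"
    and L_smul: "L (smul (mps_var z') \<Psi>) = mps_var z' * L \<Psi>"
    and L_b: "k \<in> {1 - int N..0} \<Longrightarrow> (\<Sum>j\<in>?I. S k j * L (\<lambda>m. b_op j (\<Psi> m))) = 0"
    and L_vac: "det (mat N N (\<lambda>(i, k). S (- int k) (- int i))) * L (const_series vac) = 1"
    for \<Psi> \<Xi> k z'
    using inv by (simp_all add: row_invariant_def)
  have L_zero: "L (\<lambda>m. 0) = 0"
    using L_add[of "\<lambda>m. 0" "\<lambda>m. 0"] by simp
  have L_uminus: "L (\<lambda>m. - \<Psi> m) = - L \<Psi>" for \<Psi>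
    using L_add[of \<Psi> "\<lambda>m. - \<Psi> m"] by (simp add: L_zero eq_neg_iff_add_eq_0 add.commute)
  have L_diff: "L (\<lambda>m. \<Psi> m - \<Xi> m) = L \<Psi> - L \<Xi>" for \<Psi> \<Xi>
    using L_add[of \<Psi> "\<lambda>m. - \<Xi> m"] by (simp add: L_uminus)
  have L_bE: "L (\<lambda>m. b_op j (?E \<Psi> m)) = L (?E (\<lambda>m. b_op j (\<Psi> m)))
      - (if j = p then ?z * L (?E (\<lambda>m. b_op q (\<Psi> m))) else 0)" for j \<Psi>
    unfolding b_act_factor[OF pq] by (cases "j = p") (simp_all add: L_diff L_smul)
  have lin: "(\<Sum>j\<in>?I. row_op ?z p q (S k) j * L (?E (\<lambda>m. b_op j (\<Psi> m)))) = 0"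
    if k: "k \<in> {1 - int N..0}" for k \<Psi>
  proof -
    let ?e = "\<lambda>j. L (?E (\<lambda>m. b_op j (\<Psi> m)))"
    have "(\<Sum>j\<in>?I. row_op ?z p q (S k) j * ?e j)
        = (\<Sum>j\<in>?I. S k j * ?e j) - (\<Sum>j\<in>?I. if j = q then ?z * S k p * ?e q else 0)"
      unfolding sum_subtractf[symmetric]
      by (intro sum.cong refl) (auto simp: row_op_def algebra_simps)
    also have "(\<Sum>j\<in>?I. if j = q then ?z * S k p * ?e q else 0) = ?z * S k p * ?e q"
      using q by simp
    also have "(\<Sum>j\<in>?I. S k j * ?e j) = (\<Sum>j\<in>?I. S k j * L (\<lambda>m. b_op j (?E \<Psi> m)))
        + (\<Sum>j\<in>?I. if j = p then S k p * (?z * ?e q) else 0)"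
      unfolding L_bE sum.distrib[symmetric]
      by (intro sum.cong refl) (auto simp: algebra_simps)
    also have "(\<Sum>j\<in>?I. if j = p then S k p * (?z * ?e q) else 0) = S k p * (?z * ?e q)"
      using p by simp
    finally show ?thesis by (simp add: L_b[OF k] mult_ac)
  qed
  have detq: "mat N N (\<lambda>(i, k). row_op ?z p q (S (- int k)) (- int i))
      = mat N N (\<lambda>(i, k). if i = nat (- q) then S (- int k) (- int i) - ?z * S (- int k) p
          else S (- int k) (- int i))" if "q \<le> 0"
    using that by (intro eq_matI) (auto simp: row_op_def)
  have det0: "mat N N (\<lambda>(i, k). row_op ?z p q (S (- int k)) (- int i))
      = mat N N (\<lambda>(i, k). S (- int k) (- int i))" if "q \<ge> 1"
    using that by (intro eq_matI) (auto simp: row_op_def)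
  have "det (mat N N (\<lambda>(i, k). row_op ?z p q (S (- int k)) (- int i))) * L (?E (const_series vac)) = 1"
  proof (cases "p \<le> 0 \<or> q \<ge> 1")
    case True
    have "det (mat N N (\<lambda>(i, k). row_op ?z p q (S (- int k)) (- int i)))
        = det (mat N N (\<lambda>(i, k). S (- int k) (- int i)))"
    proof (cases "q \<ge> 1")
      case False
      then have "mat N N (\<lambda>(i, k). row_op ?z p q (S (- int k)) (- int i))
        = mat N N (\<lambda>(i, k). if i = nat (- q) then S (- int k) (- int i) - ?z * S (- int k) (- int (nat (- p)))
          else S (- int k) (- int i))"
        using True by (subst detq) auto
      then show ?thesis
        using det_add_other_row[where q = "nat (- q)" and p = "nat (- p)" and n = N and z = ?z
            and A = "\<lambda>i k. S (- int k) (- int i)"]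
          False True p q pq N by simp
    qed (simp add: det0)
    then show ?thesis
      using L_vac by (simp add: act_factor_const_vac[OF pq True])
  next
    case False
    let ?\<Phi> = "pair_series z p q"
    let ?w = "L (?E (const_series vac))"
    let ?v = "\<lambda>i. L (\<lambda>m. b_op (- int i) (?\<Phi> m))"
    have w: "?w = L (const_series vac) + ?z * L (\<lambda>m. b_op q (?\<Phi> m))"
      unfolding act_factor_vac factor_vac_eq_pair_series[OF pq] by (simp only: L_add L_smul)
    have "(\<Sum>i<N. S (- int k) (- int i) * ?v i) = S (- int k) p * ?w" if k: "k < N" for k
    proof -
      have bj: "L (\<lambda>m. b_op j (?\<Phi> m)) = (if j = p then - ?w else 0)" if "j \<ge> 1" for j
        using that False b_pair_series[OF pq _ that, of z]
        by (simp add: act_factor_vac L_uminus L_zero)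
      have "0 = (\<Sum>j\<in>?I. S (- int k) j * L (\<lambda>m. b_op j (?\<Phi> m)))"
        using L_b[of "- int k" ?\<Phi>] k by simp
      also have "?I = {1 - int N..0} \<union> {1..int M}" using N by auto
      also have "(\<Sum>j\<in>{1 - int N..0} \<union> {1..int M}. S (- int k) j * L (\<lambda>m. b_op j (?\<Phi> m)))
          = (\<Sum>j\<in>{1 - int N..0}. S (- int k) j * L (\<lambda>m. b_op j (?\<Phi> m)))
            + (\<Sum>j\<in>{1..int M}. S (- int k) j * L (\<lambda>m. b_op j (?\<Phi> m)))"
        by (rule sum.union_disjoint) auto
      also have "(\<Sum>j\<in>{1..int M}. S (- int k) j * L (\<lambda>m. b_op j (?\<Phi> m)))
          = (\<Sum>j\<in>{1..int M}. if j = p then - (S (- int k) p * ?w) else 0)"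
        by (rule sum.cong) (auto simp: bj)
      also have "\<dots> = - (S (- int k) p * ?w)"
        using p False by simp
      also have "(\<Sum>j\<in>{1 - int N..0}. S (- int k) j * L (\<lambda>m. b_op j (?\<Phi> m)))
          = (\<Sum>i<N. S (- int k) (- int i) * ?v i)"
        by (rule sum.reindex_bij_witness[of _ "\<lambda>i. - int i" "\<lambda>j. nat (- j)"]) auto
      finally show ?thesis by simp
    qed
    then have "det (mat N N (\<lambda>(i, k). if i = nat (- q) then S (- int k) (- int i) - ?z * S (- int k) p
          else S (- int k) (- int i))) * ?w
        = det (mat N N (\<lambda>(i, k). S (- int k) (- int i))) * (?w - ?z * ?v (nat (- q)))"
      using q False by (intro det_replace_row_solution) auto
    moreover have "?w - ?z * ?v (nat (- q)) = L (const_series vac)"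
      using False by (simp add: w)
    moreover have "q \<le> 0" using False by simp
    ultimately show ?thesis
      using L_vac unfolding detq[OF \<open>q \<le> 0\<close>] by simp
  qed
  then show ?thesis
    unfolding row_invariant_def using lin
    by (simp add: act_add L_add act_factor_smul L_smul)
qed

theorem row_invariant_word:
  assumes N: "N \<ge> 1"
    and ws: "\<And>z p q. (z, p, q) \<in> set ws \<Longrightarrow> p \<in> {1 - int N..int M} \<and> q \<in> {1 - int N..int M} \<and> p \<noteq> q"
  shows "row_invariant M N (\<lambda>\<Psi>. vev_series (foldr act (map factor ws) \<Psi>))
    (\<lambda>k. fold (\<lambda>(z, p, q). row_op (mps_var z) p q) ws (\<lambda>j. if j = k then 1 else 0))"
  using ws
proof (induction ws rule: rev_induct)
  case Nil
  then show ?case by (simp add: row_invariant_Nil)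
next
  case (snoc w ws)
  obtain z p q where w: "w = (z, p, q)" by (cases w) auto
  have "row_invariant M N (\<lambda>\<Psi>. vev_series (foldr act (map factor ws) (act (factor (z, p, q)) \<Psi>)))
    (\<lambda>k. row_op (mps_var z) p q
      (fold (\<lambda>(z, p, q). row_op (mps_var z) p q) ws (\<lambda>j. if j = k then 1 else 0)))"
    by (rule row_invariant_step[where L = "\<lambda>\<Psi>. vev_series (foldr act (map factor ws) \<Psi>)"])
       (use snoc.IH snoc.prems[of z p q] snoc.prems N w in auto)
  then show ?case by (simp add: w)
qed

end

section \<open>The infinite products on tame vectors\<close>

context charged_free_bosons
begin

text \<open>A vector generated from the vacuum by \<open>a\<^sub>i\<close> with \<open>i \<ge> 1\<close> and \<open>b\<^sub>j\<close> with \<open>- r < j \<le> 0\<close> is of this kind.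
On such vectors the infinite products are finite.\<close>

definition tame :: "nat \<Rightarrow> 'v set" where
  "tame r = {v. \<forall>l\<le>- int r. a_op l v = 0}"

lemma tame_mono: "r \<le> s \<Longrightarrow> tame r \<subseteq> tame s"
  by (auto simp: tame_def)

lemma zero_in_tame: "0 \<in> tame r"
  by (simp add: tame_def a_op_linear)

lemma vac_in_tame: "vac \<in> tame 0"
  by (simp add: tame_def a_vac)

lemma act_factor_tame:
  assumes "\<And>m. \<Psi> m \<in> tame r" "q > - int r"
  shows "act (factor (z, p, q)) \<Psi> m \<in> tame r"
proof -
  have "a_op l (act (factor (z, p, q)) \<Psi> m) = 0" if "l \<le> - int r" for l
  proof -
    have "a_op l (\<Psi> m) = 0" for m
      using assms(1)[of m] that by (simp add: tame_def)
    then show ?thesis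
      using assms(2) that by (subst a_act_factor_commute) (auto simp: act_zero)
  qed
  then show ?thesis by (simp add: tame_def)
qed

lemma foldr_act_factor_tame:
  assumes "\<And>m. \<Psi> m \<in> tame r" "\<And>z p q. (z, p, q) \<in> set ws \<Longrightarrow> q > - int r"
  shows "foldr act (map factor ws) \<Psi> m \<in> tame r"
  using assms(2)
proof (induction ws arbitrary: m)
  case (Cons w ws)
  then show ?case
    by (cases w) (auto intro!: act_factor_tame)
qed (simp add: assms(1))

text \<open>\<open>a\<^sub>p\<close> kills the vectors and commutes with \<open>b\<^sub>q\<close>.\<close>

lemma foldr_act_factor_trivial:
  assumes "\<And>m. \<Psi> m \<in> tame r" "\<And>z p q. (z, p, q) \<in> set ws \<Longrightarrow> p \<le> - int r \<and> p \<noteq> q"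
  shows "foldr act (map factor ws) \<Psi> = \<Psi>"
  using assms(2)
proof (induction ws)
  case (Cons w ws)
  obtain z p q where w: "w = (z, p, q)" by (cases w) auto
  then have pq: "p \<le> - int r" "p \<noteq> q" using Cons.prems by auto
  have "bilin p q (\<Psi> m) = 0" for m
  proof -
    have "a_op p (\<Psi> m) = 0" using assms(1)[of m] pq by (simp add: tame_def)
    then show ?thesis
      using b_a_commute[OF pq(2), of "\<Psi> m"] by (simp add: bilin_def b_op_linear)
  qed
  moreover have "foldr act (map factor ws) \<Psi> = \<Psi>"
    by (rule Cons.IH) (use Cons.prems in auto)
  ultimately show ?case
    by (simp add: w act_factor_trivial)
qed simp

definition B_word :: "nat \<Rightarrow> 'i \<Rightarrow> nat list \<Rightarrow> ('i \<times> int \<times> int) list" where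
  "B_word M z ks = map (\<lambda>k. (z, int M - int k, int M - int k - 1)) ks"

definition C_word :: "nat \<Rightarrow> 'i \<Rightarrow> nat list \<Rightarrow> ('i \<times> int \<times> int) list" where
  "C_word M z ks = map (\<lambda>k. (z, int M - int k - 1, int M - int k)) ks"

lemma const_series_tame: "v \<in> tame r \<Longrightarrow> const_series v m \<in> tame r"
  by (simp add: const_series_def zero_in_tame)

text \<open>The first \<open>M + r\<close> factors are those with \<open>i > - r\<close>. All others stand to their right and fix \<open>v\<close>.\<close>

lemma Bstar_apply:
  assumes v: "v \<in> tame r" and K: "K \<ge> M + r"
  shows "Bstar scale \<phi> \<phi>s M z p v = op_prod (map factor (B_word M z [0..<K])) p v"
proof -
  have word: "map (\<lambda>k. let i = int M - int k in op_exp scale z (\<lambda>v. \<phi> (- i) (\<phi>s (i - 1) v))) ks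
      = map factor (B_word M z ks)" for ks
    by (simp add: B_word_def factor_def bilin_def[abs_def] a_op_def Let_def)
  have "op_prod (map factor (B_word M z [0..<K'])) p v
      = foldr act (map factor (B_word M z [0..<M + r])) (const_series v) p" if "K' \<ge> M + r" for K'
  proof -
    have "[0..<K'] = [0..<M + r] @ [M + r..<K']"
      using upt_add_eq_append[of 0 "M + r" "K' - (M + r)"] that by simp
    then have "op_prod (map factor (B_word M z [0..<K'])) p v
        = foldr act (map factor (B_word M z [0..<M + r]))
            (foldr act (map factor (B_word M z [M + r..<K'])) (const_series v)) p"
      by (simp add: fun_cong[OF op_prod_eq_foldr_act] B_word_def)
    also have "foldr act (map factor (B_word M z [M + r..<K'])) (const_series v) = const_series v"
      by (rule foldr_act_factor_trivial[of _ r]) (auto simp: B_word_def const_series_tame[OF v])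
    finally show ?thesis .
  qed
  then show ?thesis
    unfolding Bstar_def word using K by (intro op_lim_eqI[of "M + r"]) simp
qed

text \<open>Here the trivial factors stand on the left of the first \<open>M + r - 1\<close> ones, which therefore have to preserve
tameness. They do so because they involve \<open>b\<^sub>i\<close> only for \<open>i > 1 - r\<close>.\<close>

lemma Cstar_apply:
  assumes v: "v \<in> tame r" and K: "K + 1 \<ge> M + r"
  shows "Cstar scale \<phi> \<phi>s M z p v = op_prod (map factor (C_word M z (rev [0..<K]))) p v"
proof -
  have word: "map (\<lambda>k. let i = int M - int k in op_exp scale z (\<lambda>v. \<phi> (- i + 1) (\<phi>s i v))) ks
      = map factor (C_word M z ks)" for ks
    by (simp add: C_word_def factor_def bilin_def[abs_def] a_op_def Let_def)
  \<comment> \<open>the factor \<open>i = 1 - r\<close> is already trivial, since its left index is \<open>- r\<close>\<close>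
  define K0 where "K0 = M + r - 1"
  have "op_prod (map factor (C_word M z (rev [0..<K']))) p v
      = foldr act (map factor (C_word M z (rev [0..<K0]))) (const_series v) p" if "K' \<ge> K0" for K'
  proof -
    have "[0..<K'] = [0..<K0] @ [K0..<K']"
      using upt_add_eq_append[of 0 "K0" "K' - K0"] that by simp
    then have "op_prod (map factor (C_word M z (rev [0..<K']))) p v
        = foldr act (map factor (C_word M z (rev [K0..<K'])))
            (foldr act (map factor (C_word M z (rev [0..<K0]))) (const_series v)) p"
      by (simp add: fun_cong[OF op_prod_eq_foldr_act] C_word_def)
    also have "foldr act (map factor (C_word M z (rev [K0..<K'])))
        (foldr act (map factor (C_word M z (rev [0..<K0]))) (const_series v))
      = foldr act (map factor (C_word M z (rev [0..<K0]))) (const_series v)"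
    proof (rule foldr_act_factor_trivial[of _ r])
      show "foldr act (map factor (C_word M z (rev [0..<K0]))) (const_series v) m \<in> tame r" for m
        by (rule foldr_act_factor_tame) (auto simp: C_word_def K0_def const_series_tame[OF v])
    qed (auto simp: C_word_def K0_def)
    finally show ?thesis .
  qed
  then show ?thesis
    unfolding Cstar_def word using K by (intro op_lim_eqI[of K0]) (simp add: K0_def)
qed

lemma act_Bstar:
  assumes \<Psi>: "\<And>m. \<Psi> m \<in> tame r" and K: "K \<ge> M + r"
  shows "act (Bstar scale \<phi> \<phi>s M z) \<Psi> = foldr act (map factor (B_word M z [0..<K])) \<Psi>"
proof -
  have "act (Bstar scale \<phi> \<phi>s M z) \<Psi> = act (op_prod (map factor (B_word M z [0..<K]))) \<Psi>"
    by (rule act_cong) (rule Bstar_apply[OF \<Psi> K])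
  then show ?thesis by (subst (asm) act_op_prod) auto
qed

lemma act_Bstar_tame:
  assumes \<Psi>: "\<And>m. \<Psi> m \<in> tame r"
  shows "act (Bstar scale \<phi> \<phi>s M z) \<Psi> m \<in> tame (Suc r)"
  unfolding act_Bstar[OF \<Psi> order_refl]
proof (rule foldr_act_factor_tame)
  show "\<Psi> m \<in> tame (Suc r)" for m
    using \<Psi> tame_mono[of r "Suc r"] by auto
qed (auto simp: B_word_def)

lemma act_Cstar:
  assumes \<Psi>: "\<And>m. \<Psi> m \<in> tame r" and K: "K + 1 \<ge> M + r"
  shows "act (Cstar scale \<phi> \<phi>s M z) \<Psi> = foldr act (map factor (C_word M z (rev [0..<K]))) \<Psi>"
proof -
  have "act (Cstar scale \<phi> \<phi>s M z) \<Psi> = act (op_prod (map factor (C_word M z (rev [0..<K])))) \<Psi>"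
    by (rule act_cong) (rule Cstar_apply[OF \<Psi> K])
  then show ?thesis by (subst (asm) act_op_prod) auto
qed

lemma foldr_act_Bstar_tame:
  "foldr act (map (Bstar scale \<phi> \<phi>s M) zs) (const_series vac) m \<in> tame (length zs)"
proof (induction zs arbitrary: m)
  case Nil
  then show ?case by (simp add: const_series_tame[OF vac_in_tame])
next
  case (Cons z zs)
  then show ?case using act_Bstar_tame[OF Cons.IH] by simp
qed

lemma foldr_act_Bstar:
  assumes "length zs \<le> N" "K + 1 \<ge> M + N"
  shows "foldr act (map (Bstar scale \<phi> \<phi>s M) zs) (const_series vac)
    = foldr act (map factor (concat (map (\<lambda>z. B_word M z [0..<K]) zs))) (const_series vac)"
  using assms(1)
proof (induction zs)
  case (Cons z zs)
  have "K \<ge> M + length zs" using Cons.prems assms(2) by simp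
  then have "act (Bstar scale \<phi> \<phi>s M z) (foldr act (map (Bstar scale \<phi> \<phi>s M) zs) (const_series vac))
      = foldr act (map factor (B_word M z [0..<K]))
          (foldr act (map (Bstar scale \<phi> \<phi>s M) zs) (const_series vac))"
    by (rule act_Bstar[OF foldr_act_Bstar_tame])
  then show ?case
    using Cons by simp
qed simp

lemma foldr_act_Cstar_tame:
  assumes \<Psi>: "\<And>m. \<Psi> m \<in> tame N" and K: "K + 1 = M + N"
  shows "foldr act (map (Cstar scale \<phi> \<phi>s M) zs) \<Psi> m \<in> tame N"
proof (induction zs arbitrary: m)
  case (Cons z zs)
  have "foldr act (map factor (C_word M z (rev [0..<K])))
      (foldr act (map (Cstar scale \<phi> \<phi>s M) zs) \<Psi>) m \<in> tame N"
    using K by (intro foldr_act_factor_tame Cons.IH) (auto simp: C_word_def)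
  then show ?case
    using act_Cstar[OF Cons.IH, of M K z] K by simp
qed (simp add: \<Psi>)

lemma foldr_act_Cstar:
  assumes \<Psi>: "\<And>m. \<Psi> m \<in> tame N" and K: "K + 1 = M + N"
  shows "foldr act (map (Cstar scale \<phi> \<phi>s M) zs) \<Psi>
    = foldr act (map factor (concat (map (\<lambda>z. C_word M z (rev [0..<K])) zs))) \<Psi>"
proof (induction zs)
  case (Cons z zs)
  have "act (Cstar scale \<phi> \<phi>s M z) (foldr act (map (Cstar scale \<phi> \<phi>s M) zs) \<Psi>)
      = foldr act (map factor (C_word M z (rev [0..<K])))
          (foldr act (map (Cstar scale \<phi> \<phi>s M) zs) \<Psi>)"
    using K by (intro act_Cstar[of _ N] foldr_act_Cstar_tame[OF \<Psi>]) auto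
  then show ?case
    using Cons.IH by simp
qed simp

text \<open>The factors with \<open>2 - N \<le> i \<le> M\<close> of each product; there are \<open>M + N - 1\<close> of them. Each \<open>B\<^sup>*\<close> lowers the smallest
index in use by one, so that \<open>N\<close> of them acting on the vacuum reach \<open>1 - N\<close>, and each \<open>C\<^sup>*\<close> stays in this
range. The same range is used for all products to make the row operations uniform.\<close>

definition correlator_word :: "nat \<Rightarrow> nat \<Rightarrow> (xy_var \<times> int \<times> int) list" where
  "correlator_word M N =
     concat (map (\<lambda>i. C_word M (Xvar i) (rev [0..<M + N - 1])) (rev [1..<N + 1])) @
     concat (map (\<lambda>i. B_word M (Yvar i) [0..<M + N - 1]) [1..<N + 1])"

lemma correlator_eq_word:
  assumes "M \<ge> 1" "N \<ge> 1"
  shows "correlator scale \<phi> \<phi>s vac dvac M N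
    = vev_series (foldr act (map factor (correlator_word M N)) (const_series vac))"
proof -
  define K where "K = M + N - 1"
  have K: "K + 1 = M + N" using assms by (simp add: K_def)
  define xs where "xs = map Xvar (rev [1..<N + 1])"
  define ys where "ys = map Yvar [1..<N + 1]"
  have ys: "length ys = N" by (simp add: ys_def)
  let ?\<Psi> = "foldr act (map (Bstar scale \<phi> \<phi>s M) ys) (const_series vac)"
  have tame: "?\<Psi> m \<in> tame N" for m
    using foldr_act_Bstar_tame[of M ys m] by (simp only: ys)
  have "(\<lambda>m. op_prod (map (Cstar scale \<phi> \<phi>s M) xs @ map (Bstar scale \<phi> \<phi>s M) ys) m vac)
      = foldr act (map (Cstar scale \<phi> \<phi>s M) xs) ?\<Psi>"
    by (simp only: op_prod_eq_foldr_act foldr_append)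
  also have "\<dots> = foldr act (map factor (concat (map (\<lambda>z. C_word M z (rev [0..<K])) xs))) ?\<Psi>"
    by (rule foldr_act_Cstar[OF tame K])
  also have "?\<Psi> = foldr act (map factor (concat (map (\<lambda>z. B_word M z [0..<K]) ys))) (const_series vac)"
    using K ys by (intro foldr_act_Bstar) auto
  also have "foldr act (map factor (concat (map (\<lambda>z. C_word M z (rev [0..<K])) xs))) \<dots>
      = foldr act (map factor (correlator_word M N)) (const_series vac)"
    unfolding correlator_word_def xs_def ys_def K_def by (simp only: map_append foldr_append map_map comp_def)
  finally have "(\<lambda>m. op_prod (map (Cstar scale \<phi> \<phi>s M) xs @ map (Bstar scale \<phi> \<phi>s M) ys) m vac)
      = foldr act (map factor (correlator_word M N)) (const_series vac)" .
  then show ?thesis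
    unfolding correlator_def vev_def vev_series_def xs_def ys_def map_map comp_def
    by (simp only: fun_eq_iff)
qed

end

section \<open>The correlator\<close>

context charged_free_bosons
begin

lemma fold_row_ops_C_words:
  fixes M N K :: nat and k :: int
  assumes k: "1 - int N \<le> k" "k \<le> int M" and K: "K + 1 = M + N" and "distinct ns"
  shows "fold (\<lambda>(z, p, q). row_op (mps_var z) p q)
      (concat (map (\<lambda>i. C_word M (Xvar i) (rev [0..<K])) ns)) (\<lambda>j. if j = k then 1 else 0 :: (xy_var, 'a) mps)
    = (\<lambda>j. if j \<le> int M then alt_sign (j - k) * hsym (set ns) (\<lambda>i. mps_var (Xvar i)) (j - k) else 0)"
  using assms(4)
proof (induction ns rule: rev_induct)
  case Nil
  show ?case using k(2) by (auto simp: hsym_empty fun_eq_iff)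
next
  case (snoc i ns)
  let ?x = "\<lambda>i. mps_var (Xvar i) :: (xy_var, 'a) mps"
  have set_snoc: "insert i (set ns) = set (ns @ [i])" by simp
  let ?ops = "fold (\<lambda>(z, p, q). row_op (mps_var z) p q)"
  have word: "?ops (C_word M (Xvar i) (rev [0..<K])) s
      = fold (\<lambda>j. row_op (?x i) (int M - int j - 1) (int M - int j)) (rev [0..<K]) s" for s
    by (simp add: C_word_def fold_map comp_def)
  have IH: "?ops (concat (map (\<lambda>i. C_word M (Xvar i) (rev [0..<K])) ns)) (\<lambda>j. if j = k then 1 else 0)
      = (\<lambda>j. if j \<le> int M then alt_sign (j - k) * hsym (set ns) ?x (j - k) else 0)"
    using snoc by simp
  have "?ops (concat (map (\<lambda>i. C_word M (Xvar i) (rev [0..<K])) (ns @ [i]))) (\<lambda>j. if j = k then 1 else 0)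
      = fold (\<lambda>j. row_op (?x i) (int M - int j - 1) (int M - int j)) (rev [0..<K])
          (\<lambda>j. if j \<le> int M then alt_sign (j - k) * hsym (set ns) ?x (j - k) else 0)"
    by (simp only: map_append concat_append fold_append comp_apply IH list.map concat.simps append_Nil2 word)
  also have "\<dots> = (\<lambda>j. if j \<le> int M then alt_sign (j - k) * hsym (insert i (set ns)) ?x (j - k) else 0)"
    by (rule row_ops_ascending_hsym[where x = ?x]) (use snoc.prems k K in auto)
  finally show ?case
    unfolding set_snoc .
qed

lemma fold_row_ops_B_words:
  fixes M N K :: nat and c :: "int \<Rightarrow> (xy_var, 'a) mps"
  assumes K: "K + 1 = M + N" and "distinct ns"
  shows "fold (\<lambda>(z, p, q). row_op (mps_var z) p q)
      (concat (map (\<lambda>i. B_word M (Yvar i) [0..<K]) ns)) c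
    = (\<lambda>j. if 1 - int N \<le> j \<and> j \<le> int M
        then \<Sum>s\<in>{1 - int N..int M}. alt_sign (s - j) * hsym (set ns) (\<lambda>i. mps_var (Yvar i)) (s - j) * c s
        else c j)"
  using assms(2)
proof (induction ns rule: rev_induct)
  case Nil
  have "(\<Sum>s\<in>{1 - int N..int M}. alt_sign (s - j) * hsym {} (\<lambda>i. mps_var (Yvar i)) (s - j) * c s) = c j"
    if "1 - int N \<le> j" "j \<le> int M" for j
  proof -
    have "(\<Sum>s\<in>{1 - int N..int M}. alt_sign (s - j) * hsym {} (\<lambda>i. mps_var (Yvar i)) (s - j) * c s)
        = (\<Sum>s\<in>{1 - int N..int M}. if s = j then c s else 0)"
      by (rule sum.cong) (auto simp: hsym_empty)
    then show ?thesis using that by simp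
  qed
  then show ?case by (auto simp: fun_eq_iff)
next
  case (snoc i ns)
  let ?y = "\<lambda>i. mps_var (Yvar i) :: (xy_var, 'a) mps"
  have set_snoc: "insert i (set ns) = set (ns @ [i])" by simp
  let ?ops = "fold (\<lambda>(z, p, q). row_op (mps_var z) p q)"
  let ?t = "\<lambda>V j. if 1 - int N \<le> j \<and> j \<le> int M
      then \<Sum>s\<in>{1 - int N..int M}. alt_sign (s - j) * hsym V ?y (s - j) * c s else c j"
  have lo: "int M - int K = 1 - int N" using K by linarith
  have word: "?ops (B_word M (Yvar i) [0..<K]) s
      = fold (\<lambda>j. row_op (?y i) (int M - int j) (int M - int j - 1)) [0..<K] s" for s
    by (simp add: B_word_def fold_map comp_def)
  have IH: "?ops (concat (map (\<lambda>i. B_word M (Yvar i) [0..<K]) ns)) c = ?t (set ns)"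
    using snoc by simp
  have "?ops (concat (map (\<lambda>i. B_word M (Yvar i) [0..<K]) (ns @ [i]))) c
      = fold (\<lambda>j. row_op (?y i) (int M - int j) (int M - int j - 1)) [0..<K] (?t (set ns))"
    by (simp only: map_append concat_append fold_append comp_apply IH list.map concat.simps append_Nil2 word)
  also have "\<dots> = ?t (insert i (set ns))"
    by (rule row_ops_descending_hsym[where y = ?y and M = "int M" and K = K, unfolded lo])
       (use snoc.prems in auto)
  finally show ?case
    unfolding set_snoc .
qed

text \<open>By \<open>row_invariant_word\<close> the correlator is the reciprocal of a determinant. Its matrix arises from the unit columns
by the row operations of the \<open>C\<close>-words, which produce \<open>h(x)\<close>, followed by those of the \<open>B\<close>-words, which convolve
the result with \<open>h(y)\<close>.\<close>

theorem correlator_times_schur_sum: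
  assumes M: "M \<ge> 1" and N: "N \<ge> 1"
  shows "(\<Sum>\<mu> | is_partition \<mu> \<and> length \<mu> \<le> N \<and> (\<forall>k\<in>set \<mu>. k \<le> M).
      schur N (\<lambda>i. mps_var (Xvar i)) \<mu> * schur N (\<lambda>i. mps_var (Yvar i)) \<mu>)
    * correlator scale \<phi> \<phi>s vac dvac M N = 1"
proof -
  let ?x = "\<lambda>i. mps_var (Xvar i) :: (xy_var, 'a) mps"
  let ?y = "\<lambda>i. mps_var (Yvar i) :: (xy_var, 'a) mps"
  define K where "K = M + N - 1"
  have K: "K + 1 = M + N" using M by (simp add: K_def)
  let ?I = "{1 - int N..int M}"
  let ?S = "\<lambda>k. fold (\<lambda>(z, p, q). row_op (mps_var z) p q) (correlator_word M N)
    (\<lambda>j. if j = k then 1 else (0 :: (xy_var, 'a) mps))"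
  have valid: "p \<in> ?I \<and> q \<in> ?I \<and> p \<noteq> q" if "(z, p, q) \<in> set (correlator_word M N)" for z p q
    using that M N by (auto simp: correlator_word_def B_word_def C_word_def)
  have inv: "det (mat N N (\<lambda>(i, k). ?S (- int k) (- int i))) * correlator scale \<phi> \<phi>s vac dvac M N = 1"
  proof -
    have "row_invariant M N (\<lambda>\<Psi>. vev_series (foldr act (map factor (correlator_word M N)) \<Psi>)) ?S"
      by (rule row_invariant_word[OF N]) (rule valid)
    then show ?thesis
      unfolding row_invariant_def correlator_eq_word[OF M N] by blast
  qed
  have S: "?S (- int k) (- int i) = alt_sign (int i) * alt_sign (int k) *
      (\<Sum>s\<in>?I. complete_sym N ?y (s + int i) * complete_sym N ?x (s + int k))"
    if "i < N" "k < N" for i k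
  proof -
    have sets: "set [1..<N + 1] = {1..N}" "set (rev [1..<N + 1]) = {1..N}" by auto
    let ?ops = "fold (\<lambda>(z, p, q). row_op (mps_var z) p q)"
    let ?c = "\<lambda>j. if j \<le> int M then alt_sign (j - - int k) * hsym {1..N} ?x (j - - int k) else 0"
    have C: "?ops (concat (map (\<lambda>i. C_word M (Xvar i) (rev [0..<K])) (rev [1..<N + 1])))
        (\<lambda>j. if j = - int k then 1 else 0) = ?c"
      by (rule fold_row_ops_C_words[where N = N and ns = "rev [1..<N + 1]", unfolded sets])
         (use that K in auto)
    have B: "?ops (concat (map (\<lambda>i. B_word M (Yvar i) [0..<K]) [1..<N + 1])) ?c
      = (\<lambda>j. if 1 - int N \<le> j \<and> j \<le> int M
        then \<Sum>s\<in>?I. alt_sign (s - j) * hsym {1..N} ?y (s - j) * ?c s else ?c j)"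
      by (rule fold_row_ops_B_words[where N = N and ns = "[1..<N + 1]", unfolded sets]) (use K in auto)
    have "?S (- int k) = (\<lambda>j. if 1 - int N \<le> j \<and> j \<le> int M
        then \<Sum>s\<in>?I. alt_sign (s - j) * hsym {1..N} ?y (s - j) * ?c s else ?c j)"
      by (simp only: correlator_word_def K_def[symmetric] fold_append comp_apply C B)
    then have "?S (- int k) (- int i) = (\<Sum>s\<in>?I. alt_sign (s + int i) * hsym {1..N} ?y (s + int i) *
          (if s \<le> int M then alt_sign (s + int k) * hsym {1..N} ?x (s + int k) else 0))"
      using that by simp
    also have "\<dots> = (\<Sum>s\<in>?I. alt_sign (int i) * alt_sign (int k) *
        (complete_sym N ?y (s + int i) * complete_sym N ?x (s + int k)))"
    proof (rule sum.cong[OF refl])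
      fix s assume s: "s \<in> ?I"
      have sign: "alt_sign (s + int i) * alt_sign (s + int k)
          = (alt_sign (int i) * alt_sign (int k) :: (xy_var, 'a) mps)"
        by (auto simp: alt_sign_def)
      have "alt_sign (s + int i) * h * (alt_sign (s + int k) * g) = alt_sign (int i) * alt_sign (int k) * (h * g)"
        for h g :: "(xy_var, 'a) mps"
        by (simp only: sign[symmetric] mult_ac)
      then show "alt_sign (s + int i) * hsym {1..N} ?y (s + int i) *
          (if s \<le> int M then alt_sign (s + int k) * hsym {1..N} ?x (s + int k) else 0)
        = alt_sign (int i) * alt_sign (int k) *
          (complete_sym N ?y (s + int i) * complete_sym N ?x (s + int k))"
        using s by (simp only: complete_sym_eq_hsym atLeastAtMost_iff if_True)
    qed
    finally show ?thesis by (simp add: sum_distrib_left)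
  qed
  have "mat N N (\<lambda>(i, k). ?S (- int k) (- int i)) = mat N N (\<lambda>(i, k). alt_sign (int i) * alt_sign (int k) *
      (\<Sum>s\<in>?I. complete_sym N ?y (s + int i) * complete_sym N ?x (s + int k)))"
    using S by (intro eq_matI) auto
  also have "det \<dots>
      = det (mat N N (\<lambda>(i, k). \<Sum>s\<in>?I. complete_sym N ?y (s + int i) * complete_sym N ?x (s + int k)))"
    by (rule det_conjugate_signs) (simp add: alt_sign_def)
  also have "\<dots> = (\<Sum>\<mu> | is_partition \<mu> \<and> length \<mu> \<le> N \<and> (\<forall>k\<in>set \<mu>. k \<le> M).
      schur N ?x \<mu> * schur N ?y \<mu>)"
    by (subst schur_sum_eq_det[symmetric]) (simp add: mult.commute)
  finally show ?thesis using inv by simp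
qed

end

theorem theorem3p2:
  fixes scale :: "'a :: field_char_0 \<Rightarrow> 'v :: ab_group_add \<Rightarrow> 'v"
    and \<phi> \<phi>s :: "int \<Rightarrow> 'v \<Rightarrow> 'v"
    and vac :: 'v and dvac :: "'v \<Rightarrow> 'a"
    and M N :: nat
  assumes "charged_free_bosons scale \<phi> \<phi>s vac dvac"
    and "M \<ge> 1" and "N \<ge> 1"
  shows
    "let x = \<lambda>i. mps_var (Xvar i) :: (xy_var, 'a) mps;
         y = \<lambda>i. mps_var (Yvar i) :: (xy_var, 'a) mps in
       correlator scale \<phi> \<phi>s vac dvac M N =
           1 / (\<Sum>\<mu> | is_partition \<mu> \<and> length \<mu> \<le> N \<and> (\<forall>k\<in>set \<mu>. k \<le> M). schur N x \<mu> * schur N y \<mu>)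
       \<and> (\<lambda>L. correlator scale \<phi> \<phi>s vac dvac L N) \<longlonglongrightarrow> (\<Prod>i=1..N. \<Prod>j=1..N. 1 - x i * y j)
       \<and> (\<Prod>i=1..N. \<Prod>j=1..N. 1 - x i * y j) =
           1 / (\<Sum>\<^sub>\<infinity>\<mu>\<in>{\<mu>. is_partition \<mu> \<and> length \<mu> \<le> N}. schur N x \<mu> * schur N y \<mu>)"
proof -
  interpret charged_free_bosons scale \<phi> \<phi>s vac dvac by fact
  let ?x = "\<lambda>i. mps_var (Xvar i) :: (xy_var, 'a) mps"
  let ?y = "\<lambda>i. mps_var (Yvar i) :: (xy_var, 'a) mps"
  let ?P = "\<Prod>i=1..N. \<Prod>j=1..N. 1 - ?x i * ?y j"
  let ?corr = "\<lambda>L. correlator scale \<phi> \<phi>s vac dvac L N"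
  define Z where "Z L = (\<Sum>\<mu> | is_partition \<mu> \<and> length \<mu> \<le> N \<and> (\<forall>k\<in>set \<mu>. k \<le> L).
    schur N ?x \<mu> * schur N ?y \<mu>)" for L
  have corr: "Z L * ?corr L = 1" if "L \<ge> 1" for L
    unfolding Z_def using correlator_times_schur_sum[OF that \<open>N \<ge> 1\<close>] .
  have ord: "order_ge 1 (?x i)" "order_ge 1 (?y i)" for i
    by (rule order_ge_var)+
  have "N > 0" using \<open>N \<ge> 1\<close> by simp
  obtain d where lim: "(\<lambda>L. det (mat N N (\<lambda>(i, j). \<Sum>s\<in>{1 - int N..int L}.
        hsym {1..N} ?y (s + int i) * hsym {1..N} ?x (s + int j)))) \<longlonglongrightarrow> d"
    and d: "d * ?P = 1"
    by (rule cauchy_identity_limit[where x = ?x and y = ?y and n = N, OF ord \<open>N > 0\<close>])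
  have "Z = (\<lambda>L. det (mat N N (\<lambda>(i, j). \<Sum>s\<in>{1 - int N..int L}.
        hsym {1..N} ?y (s + int i) * hsym {1..N} ?x (s + int j))))"
    unfolding complete_sym_eq_hsym[symmetric] schur_sum_eq_det[symmetric] Z_def
    by (simp only: mult.commute)
  with lim have Z: "Z \<longlonglongrightarrow> d" by simp
  have "1 / Z M = ?corr M"
    using corr[OF \<open>M \<ge> 1\<close>] by (simp add: divide_mps_def mps_inverse_eqI)
  moreover have "?corr \<longlonglongrightarrow> ?P"
  \<comment> \<open>the formula for the correlator needs \<open>L \<ge> 1\<close>\<close>
  proof (rule LIMSEQ_offset[of _ 1])
    show "(\<lambda>L. ?corr (L + 1)) \<longlonglongrightarrow> ?P"
    proof (rule tendsto_inverse_of_tendsto)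
      show "?corr (L + 1) * Z (L + 1) = 1" for L
        using corr[of "L + 1"] by (simp add: mult.commute)
      show "(\<lambda>L. Z (L + 1)) \<longlonglongrightarrow> d"
        by (rule LIMSEQ_ignore_initial_segment[OF Z])
    qed (rule d)
  qed
  moreover have "?P = 1 / (\<Sum>\<^sub>\<infinity>\<mu>\<in>{\<mu>. is_partition \<mu> \<and> length \<mu> \<le> N}. schur N ?x \<mu> * schur N ?y \<mu>)"
  proof -
    have "((\<lambda>\<mu>. schur N ?x \<mu> * schur N ?y \<mu>) has_sum d) {\<mu>. is_partition \<mu> \<and> length \<mu> \<le> N}"
      by (rule has_sum_schur[OF ord(1)]) (use Z in \<open>simp only: Z_def[abs_def]\<close>)
    then have "(\<Sum>\<^sub>\<infinity>\<mu>\<in>{\<mu>. is_partition \<mu> \<and> length \<mu> \<le> N}. schur N ?x \<mu> * schur N ?y \<mu>) = d"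
      by (rule infsumI)
    then show ?thesis
      using d by (simp add: divide_mps_def mps_inverse_eqI)
  qed
  ultimately show ?thesis
    unfolding Let_def Z_def by simp
qed

end
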